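(* For all $d,l,l',r,s,s',t\in\mathbb{N}$, there are constants $f=f(d,l,l',r,s,s',t)\in\mathbb{N}$ and $g=g(d,l,l',r,s,s',t)\in\mathbb{N}$ such that for every $(f,g)$-constellation $\mathfrak{c}$, one of the following holds. (a) There is an induced subgraph of $\mathfrak{c}$ isomorphic to either $K_{r,r}$ or a proper subdivision of $K_{2t+2}$. (b) There is a $d$-ample interrupted $(s,l)$-constellation which sits in $\mathfrak{c}$. (c) There is a $d$-ample $2t$-zigzagged $(s',l')$-constellation which sits in $\mathfrak{c}$.
   Context: $\mathbb{N}$ is the set of positive integers. Graphs are finite, with no loops and no parallel edges. A path in a graph $G$ is an induced subgraph of $G$ that is a path (a single vertex counts as a path); its length is its number of edges, and the interior $R^*$ of a path $R$ is $R$ minus its ends. Subdivision: a subdivision of $H$ is obtained by replacing each edge $e=uv$ by a path $P_e$ of length at least 1 from $u$ to $v$, the interiors being pairwise disjoint and with no edges between them. It is proper if every $P_e$ has length at least 2. Constellation: a graph $\mathfrak{c}$ together with a stable set $S_{\mathfrak{c}}$ such that every component of $\mathfrak{c}\setminus S_{\mathfrak{c}}$ is a path, and each $x\in S_{\mathfrak{c}}$ has at least one neighbor in each component of $\mathfrak{c}\setminus S_{\mathfrak{c}}$. $\mathcal{L}_{\mathfrak{c}}$ is the set of components of $\mathfrak{c}\setminus S_{\mathfrak{c}}$. An $(s,l)$-constellation has $|S_{\mathfrak{c}}|=s$ and $|\mathcal{L}_{\mathfrak{c}}|=l$. A $\mathfrak{c}$-route is a path $R$ in $\mathfrak{c}$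 with two distinct ends, both in $S_{\mathfrak{c}}$, and with $R^*\subseteq V(L)$ for some $L\in\mathcal{L}_{\mathfrak{c}}$. For $d\in\mathbb{N}$, $\mathfrak{c}$ is $d$-ample if there is no $\mathfrak{c}$-route of length at most $d+1$. $\mathfrak{c}$ is interrupted if there is a linear order $\preccurlyeq$ on $S_{\mathfrak{c}}$ such that for all $x,y,z\in S_{\mathfrak{c}}$ with $x\prec y\prec z$ and every $\mathfrak{c}$-route $R$ from $x$ to $y$, the vertex $z$ has a neighbor in $R$. For $q\in\mathbb{N}$, $\mathfrak{c}$ is $q$-zigzagged if there is a linear order $\preccurlyeq$ on $S_{\mathfrak{c}}$ such that for all $x,y\in S_{\mathfrak{c}}$ with $x\prec y$ and every $\mathfrak{c}$-route $R$ from $x$ to $y$, there are fewer than $q$ vertices $z\in S_{\mathfrak{c}}$ where $x\prec z\prec y$ and $z$ has no neighbor in $R$. A constellation $\mathfrak{b}$ sits in a constellation $\mathfrak{c}$ if ($\mathfrak{b}$ is an induced subgraph of $\mathfrak{c}$ and) $S_{\mathfrak{b}}\subseteq S_{\mathfrak{c}}$; for every $L\in\mathcal{L}_{\mathfrak{b}}$ there is $M\in\mathcal{L}_{\mathfrak{c}}$ with $L\subseteq M$; and for every $M\in\mathcal{L}_{\mathfrak{c}}$ there is at most one $L\in\mathcal{L}_{\mathfrak{b}}$ with $L\subseteq M$. *)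

theory Defs
  imports "Graph_Theory.Graph_Theory"
begin

text \<open>
  A finite simple graph is a \<^locale>\<open>pair_graph\<close>: a finite, symmetric, loop-free set of
  ordered pairs, in which an edge $uv$ is the two arcs $(u,v)$ and $(v,u)$. Subgraphs, induced
  subgraphs, $K_n$ and $K_{m,n}$ are those of the digraph library, via the coercion
  \<^const>\<open>with_proj\<close>; the predicates \<^const>\<open>complete_digraph\<close> and
  \<^const>\<open>complete_bipartite_digraph\<close> are invariant under isomorphism.
\<close>

section \<open>Paths and subdivisions\<close>

text \<open>
  A path of a graph (always induced) is given by the list of its vertices, in one of the two
  possible orders. Its length is \<^const>\<open>vwalk_length\<close>.
\<close>

definition induced_path :: "'a pair_pre_digraph \<Rightarrow> 'a list \<Rightarrow> bool" where
  "induced_path G p \<longleftrightarrow> vpath p (with_proj G) \<and>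
     (\<forall>i j. i < j \<and> j < length p \<and> (p ! i, p ! j) \<in> parcs G \<longrightarrow> j = Suc i)"

definition interior :: "'a list \<Rightarrow> 'a set" where
  "interior p = set (butlast (tl p))"

text \<open>
  \<open>H\<close> is the subdivision of \<open>K\<close> obtained by replacing every edge $uv$ by the path
  \<open>P (u, v)\<close>. The branch vertices are those of \<open>K\<close> itself, so that ``isomorphic to a
  subdivision of $K_n$'' becomes ``a subdivision of some \<open>K\<close> that is a $K_n$''. The path
  has length at least 1 because $u \neq v$. The last equation says that \<open>H\<close> has no edges
  other than those of the paths; in particular there are none between distinct interiors,
  and every \<open>P (u, v)\<close> is induced in \<open>H\<close>.
  (The library relation \<^const>\<open>subdivision\<close> iterates single steps and does not expose the
  paths, which are needed to speak of properness.)
\<close>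

definition subdivision_via ::
  "'a pair_pre_digraph \<Rightarrow> ('a \<times> 'a \<Rightarrow> 'a list) \<Rightarrow> 'a pair_pre_digraph \<Rightarrow> bool" where
  "subdivision_via K P H \<longleftrightarrow> pair_graph K \<and>
     (\<forall>(u, v) \<in> parcs K.
        P (u, v) \<noteq> [] \<and> hd (P (u, v)) = u \<and> last (P (u, v)) = v \<and> distinct (P (u, v)) \<and>
        P (v, u) = rev (P (u, v)) \<and> interior (P (u, v)) \<inter> pverts K = {}) \<and>
     (\<forall>(u, v) \<in> parcs K. \<forall>(x, y) \<in> parcs K.
        {u, v} \<noteq> {x, y} \<longrightarrow> interior (P (u, v)) \<inter> interior (P (x, y)) = {}) \<and>
     pverts H = pverts K \<union> (\<Union>e \<in> parcs K. set (P e)) \<and>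
     parcs H = (\<Union>e \<in> parcs K. set (vwalk_arcs (P e)))"

definition proper_subdivision :: "'a pair_pre_digraph \<Rightarrow> 'a pair_pre_digraph \<Rightarrow> bool" where
  "proper_subdivision K H \<longleftrightarrow>
     (\<exists>P. subdivision_via K P H \<and> (\<forall>e \<in> parcs K. 2 \<le> vwalk_length (P e)))"

section \<open>Constellations\<close>

text \<open>
  The components of $G \setminus S$, represented by their vertex sets. As the graph is symmetric,
  its strongly connected components are its connected components.
\<close>

definition comps :: "'a pair_pre_digraph \<Rightarrow> 'a set \<Rightarrow> 'a set set" where
  "comps G S = pre_digraph.sccs_verts (with_proj G \<restriction> (pverts G - S))"

definition constellation :: "'a pair_pre_digraph \<Rightarrow> 'a set \<Rightarrow> bool" where
  "constellation G S \<longleftrightarrow> pair_graph G \<and> S \<subseteq> pverts G \<and>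
     (\<forall>x \<in> S. \<forall>y \<in> S. (x, y) \<notin> parcs G) \<and>
     (\<forall>L \<in> comps G S. (\<exists>p. induced_path G p \<and> set p = L) \<and>
                      (\<forall>x \<in> S. \<exists>y \<in> L. (x, y) \<in> parcs G))"

definition constellation_of_size :: "nat \<Rightarrow> nat \<Rightarrow> 'a pair_pre_digraph \<Rightarrow> 'a set \<Rightarrow> bool" where
  "constellation_of_size s l G S \<longleftrightarrow>
     constellation G S \<and> card S = s \<and> card (comps G S) = l"

definition route :: "'a pair_pre_digraph \<Rightarrow> 'a set \<Rightarrow> 'a \<Rightarrow> 'a list \<Rightarrow> 'a \<Rightarrow> bool" where
  "route G S x R y \<longleftrightarrow> induced_path G R \<and> hd R = x \<and> last R = y \<and>
     x \<in> S \<and> y \<in> S \<and> x \<noteq> y \<and> (\<exists>L \<in> comps G S. interior R \<subseteq> L)"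

definition ample :: "nat \<Rightarrow> 'a pair_pre_digraph \<Rightarrow> 'a set \<Rightarrow> bool" where
  "ample d G S \<longleftrightarrow> \<not> (\<exists>x R y. route G S x R y \<and> vwalk_length R \<le> d + 1)"

definition has_neighbor_in :: "'a pair_pre_digraph \<Rightarrow> 'a \<Rightarrow> 'a set \<Rightarrow> bool" where
  "has_neighbor_in G z X \<longleftrightarrow> (\<exists>w \<in> X. (z, w) \<in> parcs G)"

text \<open>Below, \<open>le\<close> is the reflexive order and \<open>le - Id\<close> its strict part.\<close>

definition interrupted :: "'a pair_pre_digraph \<Rightarrow> 'a set \<Rightarrow> bool" where
  "interrupted G S \<longleftrightarrow> (\<exists>le. linear_order_on S le \<and>
     (\<forall>x \<in> S. \<forall>y \<in> S. \<forall>z \<in> S. (x, y) \<in> le - Id \<and> (y, z) \<in> le - Id \<longrightarrow>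
        (\<forall>R. route G S x R y \<longrightarrow> has_neighbor_in G z (set R))))"

definition zigzagged :: "nat \<Rightarrow> 'a pair_pre_digraph \<Rightarrow> 'a set \<Rightarrow> bool" where
  "zigzagged q G S \<longleftrightarrow> (\<exists>le. linear_order_on S le \<and>
     (\<forall>x \<in> S. \<forall>y \<in> S. (x, y) \<in> le - Id \<longrightarrow>
        (\<forall>R. route G S x R y \<longrightarrow>
           card {z \<in> S. (x, z) \<in> le - Id \<and> (z, y) \<in> le - Id \<and> \<not> has_neighbor_in G z (set R)} < q)))"

definition sits_in ::
  "'a pair_pre_digraph \<Rightarrow> 'a set \<Rightarrow> 'a pair_pre_digraph \<Rightarrow> 'a set \<Rightarrow> bool" where
  "sits_in H T G S \<longleftrightarrow> induced_subgraph (with_proj H) (with_proj G) \<and> T \<subseteq> S \<and>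
     (\<forall>L \<in> comps H T. \<exists>M \<in> comps G S. L \<subseteq> M) \<and>
     (\<forall>M \<in> comps G S. \<forall>L \<in> comps H T. \<forall>L' \<in> comps H T. L \<subseteq> M \<and> L' \<subseteq> M \<longrightarrow> L = L')"

end

theory Submission
  imports Defs "HOL-Library.Ramsey"
begin

text \<open>
  Fix a component \<open>L\<close>, a path, and view the vertices of \<open>S\<close> as letters written along it. A route
  between two letters \<open>x\<close> and \<open>y\<close> through \<open>L\<close> is a stretch of \<open>L\<close> in which both occur; it may avoid
  some other letters. If, on sufficiently many paths, every two letters of one fixed set of \<open>2 * t + 2\<close>
  letters have a route avoiding the other \<open>2 * t\<close>, then a proper subdivision of the complete graph
  is found by using a different path for each pair. By Ramsey's theorem such a set exists on \<open>L\<close>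
  unless, for a linear order of \<open>S\<close> fixed beforehand, some large set of letters omits a pattern
  \<open>(a, b, c)\<close> with \<open>a + b + c = 2 * t\<close>: no route between two of its letters avoids \<open>a\<close> letters below
  both, \<open>b\<close> letters between them and \<open>c\<close> letters above both
  (\<open>mutually_linked_or_pattern_free\<close>).

  The heart of the proof (\<open>unavoidable_pattern\<close>) is that every pattern with \<open>b \<le> 2 * t\<close> occurs
  unless an interrupted or zigzagged set is present. Suppose that a stretch \<open>Q\<close> realises \<open>(a, 0, c)\<close>
  and consider a block of letters just below its smaller end. If \<open>Q\<close> misses one of them, it realises
  \<open>(a + 1, 0, c)\<close>. If it contains all of them, then they can be studied inside \<open>Q\<close>: either they are
  interrupted there for the reversed order, or two of them have a route in \<open>Q\<close> that avoids a smaller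
  one, and this route also avoids everything that \<open>Q\<close> avoids, so that \<open>(a + 1, 0, c)\<close> is realised
  again. The same argument raises \<open>c\<close>, and then raises \<open>b\<close> as long as \<open>b < 2 * t\<close>, with ``zigzagged''
  in place of ``interrupted''. Passing to a stretch of \<open>L\<close> is harmless because a sub-constellation may
  use subpaths.

  Ampleness is arranged first (\<open>far_apart_subset\<close>). In a large set of letters that are pairwise at
  bounded distance on \<open>L\<close>, either some vertex of \<open>L\<close> has \<open>r\<close> neighbours, or short stretches contain
  few letters and every pattern is realised.

  So each path has an outcome that concerns a subset of \<open>S\<close>. As \<open>g\<close> is large in terms of \<open>f\<close>, many
  paths share the kind of outcome and the subset; taken together, they give one of the required
  structures.
\<close>

section \<open>Linked letters on a path\<close>

text \<open>
  The vertices of \<open>S\<close> are called letters, and a path \<open>L\<close> is replaced by its set of vertex indices.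
  The value \<open>pos x\<close> is the set of indices of the neighbours of the letter \<open>x\<close> on \<open>L\<close>. The letters
  \<open>x\<close> and \<open>y\<close> are linked in \<open>J\<close> avoiding \<open>Z\<close> if some interval of indices inside \<open>J\<close> meets \<open>pos x\<close>
  and \<open>pos y\<close> but none of the sets \<open>pos z\<close>; a shortest such interval is the interior of a route
  from \<open>x\<close> to \<open>y\<close> in which no vertex of \<open>Z\<close> has a neighbour. No direction is recorded, so the
  notion is symmetric in \<open>x\<close> and \<open>y\<close>.
\<close>

definition linked :: "('b \<Rightarrow> nat set) \<Rightarrow> nat set \<Rightarrow> 'b \<Rightarrow> 'b \<Rightarrow> 'b set \<Rightarrow> bool" where
  "linked pos J x y Z \<longleftrightarrow> (\<exists>lo hi. {lo..hi} \<subseteq> J \<and> pos x \<inter> {lo..hi} \<noteq> {} \<and>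
     pos y \<inter> {lo..hi} \<noteq> {} \<and> (\<forall>z\<in>Z. pos z \<inter> {lo..hi} = {}))"

lemma linked_commute: "linked pos J x y Z \<longleftrightarrow> linked pos J y x Z"
  unfolding linked_def by blast

lemma linked_mono:
  assumes "linked pos J x y Z" "J \<subseteq> J'" "Z' \<subseteq> Z"
  shows "linked pos J' x y Z'"
  using assms unfolding linked_def by (meson order_trans subsetD)

text \<open>
  With letters ordered as natural numbers, \<open>upper_blocked\<close> is the combinatorial form of being
  interrupted for the order \<open><\<close>, \<open>lower_blocked\<close> the one for the reversed order, and
  \<open>between_blocked q\<close> the one of being \<open>q\<close>-zigzagged: no \<open>q\<close> letters strictly between \<open>x\<close> and \<open>y\<close>
  can be avoided at once.
\<close>

definition upper_blocked :: "(nat \<Rightarrow> nat set) \<Rightarrow> nat set \<Rightarrow> nat set \<Rightarrow> bool" where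
  "upper_blocked pos J T \<longleftrightarrow>
     (\<forall>x\<in>T. \<forall>y\<in>T. \<forall>z\<in>T. x < y \<and> y < z \<longrightarrow> \<not> linked pos J x y {z})"

definition lower_blocked :: "(nat \<Rightarrow> nat set) \<Rightarrow> nat set \<Rightarrow> nat set \<Rightarrow> bool" where
  "lower_blocked pos J T \<longleftrightarrow>
     (\<forall>x\<in>T. \<forall>y\<in>T. \<forall>z\<in>T. x < y \<and> y < z \<longrightarrow> \<not> linked pos J y z {x})"

definition between_blocked :: "nat \<Rightarrow> (nat \<Rightarrow> nat set) \<Rightarrow> nat set \<Rightarrow> nat set \<Rightarrow> bool" where
  "between_blocked q pos J T \<longleftrightarrow>
     (\<forall>x\<in>T. \<forall>y\<in>T. \<forall>Z\<subseteq>T. x < y \<and> card Z = q \<and> (\<forall>z\<in>Z. x < z \<and> z < y) \<longrightarrow>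
        \<not> linked pos J x y Z)"

text \<open>
  One of the two desired structures occurs among the letters \<open>A\<close>, on a single subpath of \<open>J\<close> that
  still contains a neighbour of each chosen letter.
\<close>

definition has_blocked_set ::
  "nat \<Rightarrow> nat \<Rightarrow> nat \<Rightarrow> (nat \<Rightarrow> nat set) \<Rightarrow> nat set \<Rightarrow> nat set \<Rightarrow> bool" where
  "has_blocked_set s s' q pos J A \<longleftrightarrow>
     (\<exists>T lo hi. T \<subseteq> A \<and> {lo..hi} \<subseteq> J \<and> (\<forall>x\<in>T. pos x \<inter> {lo..hi} \<noteq> {}) \<and>
        (card T = s \<and> (upper_blocked pos {lo..hi} T \<or> lower_blocked pos {lo..hi} T) \<or>
         card T = s' \<and> between_blocked q pos {lo..hi} T))"

text \<open>
  The pattern \<open>(a, b, c)\<close>: two letters are linked avoiding at least \<open>a\<close> letters below both, \<open>b\<close>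
  letters between them and \<open>c\<close> letters above both.
\<close>

definition has_pattern ::
  "(nat \<Rightarrow> nat set) \<Rightarrow> nat set \<Rightarrow> nat set \<Rightarrow> nat \<Rightarrow> nat \<Rightarrow> nat \<Rightarrow> bool" where
  "has_pattern pos J A a b c \<longleftrightarrow>
     (\<exists>x y U. x \<in> A \<and> y \<in> A \<and> U \<subseteq> A \<and> x < y \<and> a \<le> card {u\<in>U. u < x} \<and>
        b \<le> card {u\<in>U. x < u \<and> u < y} \<and> c \<le> card {u\<in>U. y < u} \<and> linked pos J x y U)"

section \<open>Every pattern is unavoidable\<close>

text \<open>
  The bound \<open>n\<close> may not depend on the path or on the positions of the letters.
\<close>

definition unavoidable :: "nat \<Rightarrow> nat \<Rightarrow> nat \<Rightarrow> nat \<Rightarrow> nat \<Rightarrow> nat \<Rightarrow> bool" where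
  "unavoidable s s' q a b c \<longleftrightarrow>
     (\<exists>n. \<forall>pos lo hi A. finite A \<and> n \<le> card A \<and> (\<forall>x\<in>A. pos x \<inter> {lo..hi} \<noteq> {}) \<longrightarrow>
        has_blocked_set s s' q pos {lo..hi} A \<or> has_pattern pos {lo..hi} A a b c)"

text \<open>
  Next to each element of \<open>B\<close>, on either side, there are \<open>k\<close> elements of \<open>A\<close> before the next
  element of \<open>B\<close>.
\<close>

definition spaced :: "nat \<Rightarrow> nat set \<Rightarrow> nat set \<Rightarrow> bool" where
  "spaced k A B \<longleftrightarrow> B \<subseteq> A \<and> (\<forall>x\<in>B.
     (\<exists>V\<subseteq>A. card V = k \<and> (\<forall>v\<in>V. v < x \<and> (\<forall>u\<in>B. u < x \<longrightarrow> u < v))) \<and>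
     (\<exists>V\<subseteq>A. card V = k \<and> (\<forall>v\<in>V. x < v \<and> (\<forall>u\<in>B. x < u \<longrightarrow> v < u))))"

lemma spaced_below:
  assumes "spaced k A B" "x \<in> B"
  obtains V where "V \<subseteq> A" "card V = k" "\<And>v. v \<in> V \<Longrightarrow> v < x"
    "\<And>v u. v \<in> V \<Longrightarrow> u \<in> B \<Longrightarrow> u < x \<Longrightarrow> u < v"
proof -
  have "\<exists>V\<subseteq>A. card V = k \<and> (\<forall>v\<in>V. v < x \<and> (\<forall>u\<in>B. u < x \<longrightarrow> u < v))"
    using assms by (simp add: spaced_def)
  then show ?thesis using that by blast
qed

lemma spaced_above:
  assumes "spaced k A B" "x \<in> B"
  obtains V where "V \<subseteq> A" "card V = k" "\<And>v. v \<in> V \<Longrightarrow> x < v"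
    "\<And>v u. v \<in> V \<Longrightarrow> u \<in> B \<Longrightarrow> x < u \<Longrightarrow> v < u"
proof -
  have "\<exists>V\<subseteq>A. card V = k \<and> (\<forall>v\<in>V. x < v \<and> (\<forall>u\<in>B. x < u \<longrightarrow> v < u))"
    using assms by (simp add: spaced_def)
  then show ?thesis using that by blast
qed

lemma spaced_subset_exists:
  fixes A :: "nat set"
  assumes "finite A" "n * (2 * k + 1) \<le> card A"
  shows "\<exists>B. card B = n \<and> spaced k A B"
proof -
  \<comment> \<open>\<open>h\<close> enumerates \<open>A\<close> increasingly; \<open>B\<close> takes the middle of each of \<open>n\<close> consecutive blocks of size \<open>2 * k + 1\<close>.\<close>
  define h where "h i = sorted_list_of_set A ! i" for i
  let ?N = "card A" and ?w = "2 * k + 1"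
  have h_less: "h i < h j" if "i < j" "j < ?N" for i j
    unfolding h_def using that assms(1)
    by (intro sorted_wrt_nth_less[OF strict_sorted_list_of_set]) auto
  have h_inj: "inj_on h {..<?N}"
    by (intro inj_onI) (metis h_less lessThan_iff less_irrefl linorder_cases)
  have h_in: "h i \<in> A" if "i < ?N" for i
    unfolding h_def using that assms(1)
    by (metis length_sorted_list_of_set nth_mem set_sorted_list_of_set)
  have h_iff: "h i < h j \<longleftrightarrow> i < j" if "i < ?N" "j < ?N" for i j
    using that h_less by (metis less_asym less_irrefl linorder_cases)
  define g where "g i = i * ?w + k" for i
  have g_less: "g i + 2 * k < g j" if "i < j" for i j
  proof -
    have "Suc i * ?w \<le> j * ?w" using that by (intro mult_le_mono1) auto
    then show ?thesis by (simp add: g_def)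
  qed
  have g_bound: "g i + k < ?N" if "i < n" for i
  proof -
    have "Suc i * ?w \<le> n * ?w" using that by (intro mult_le_mono1) auto
    then show ?thesis using assms(2) by (simp add: g_def)
  qed
  have g_inj: "inj g"
    by (intro injI) (metis add_lessD1 g_less less_irrefl linorder_cases)
  define B where "B = h ` g ` {..<n}"
  have gsub: "g ` {..<n} \<subseteq> {..<?N}" using g_bound by fastforce
  have *: "\<exists>V\<subseteq>A. card V = k \<and> (\<forall>v\<in>V. v < x \<and> (\<forall>u\<in>B. u < x \<longrightarrow> u < v))"
       "\<exists>V\<subseteq>A. card V = k \<and> (\<forall>v\<in>V. x < v \<and> (\<forall>u\<in>B. x < u \<longrightarrow> v < u))" if "x \<in> B" for x
  proof -
    from that obtain i where i: "i < n" "x = h (g i)" unfolding B_def by auto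
    have gk: "k \<le> g i" by (simp add: g_def)
    note gi = g_bound[OF i(1)]
    show "\<exists>V\<subseteq>A. card V = k \<and> (\<forall>v\<in>V. v < x \<and> (\<forall>u\<in>B. u < x \<longrightarrow> u < v))"
    proof (intro exI[of _ "h ` {g i - k..<g i}"] conjI ballI impI)
      show "h ` {g i - k..<g i} \<subseteq> A" using gi h_in by auto
      show "card (h ` {g i - k..<g i}) = k"
        using gi gk by (subst card_image[OF inj_on_subset[OF h_inj]]) auto
      fix v assume "v \<in> h ` {g i - k..<g i}"
      then obtain j where j: "v = h j" "g i - k \<le> j" "j < g i" by auto
      show "v < x" using j i gi h_less by simp
      fix u assume "u \<in> B" "u < x"
      then obtain i' where i': "i' < n" "u = h (g i')" unfolding B_def by auto
      have "g i' < g i" using \<open>u < x\<close> i i' g_bound h_iff by (metis add_lessD1)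
      then have "i' < i" using g_less by (metis add_lessD1 less_asym less_irrefl linorder_cases)
      from g_less[OF this] show "u < v" using i' j gi gk by (auto intro!: h_less)
    qed
    show "\<exists>V\<subseteq>A. card V = k \<and> (\<forall>v\<in>V. x < v \<and> (\<forall>u\<in>B. x < u \<longrightarrow> v < u))"
    proof (intro exI[of _ "h ` {g i<..g i + k}"] conjI ballI impI)
      show "h ` {g i<..g i + k} \<subseteq> A" using gi h_in by auto
      show "card (h ` {g i<..g i + k}) = k"
        using gi by (subst card_image[OF inj_on_subset[OF h_inj]]) auto
      fix v assume "v \<in> h ` {g i<..g i + k}"
      then obtain j where j: "v = h j" "g i < j" "j \<le> g i + k" by auto
      show "x < v" using j i gi h_less by simp
      fix u assume "u \<in> B" "x < u"
      then obtain i' where i': "i' < n" "u = h (g i')" unfolding B_def by auto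
      have "g i < g i'" using \<open>x < u\<close> i i' g_bound h_iff by (metis add_lessD1)
      then have "i < i'" using g_less by (metis add_lessD1 less_asym less_irrefl linorder_cases)
      from g_less[OF this] show "v < u" using i' j g_bound[OF i'(1)] by (auto intro!: h_less)
    qed
  qed
  have "card B = n"
    unfolding B_def
    using inj_on_subset[OF h_inj gsub] inj_on_subset[OF g_inj] by (simp add: card_image)
  moreover have "B \<subseteq> A" unfolding B_def using gsub h_in by auto
  ultimately show ?thesis using * unfolding spaced_def by blast
qed

lemma has_blocked_set_mono:
  assumes "has_blocked_set s s' q pos J A" "A \<subseteq> A'" "J \<subseteq> J'"
  shows "has_blocked_set s s' q pos J' A'"
proof -
  obtain T lo hi where "T \<subseteq> A" "{lo..hi} \<subseteq> J" and *: "\<forall>x\<in>T. pos x \<inter> {lo..hi} \<noteq> {}"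
    "card T = s \<and> (upper_blocked pos {lo..hi} T \<or> lower_blocked pos {lo..hi} T) \<or>
     card T = s' \<and> between_blocked q pos {lo..hi} T"
    using assms(1) unfolding has_blocked_set_def by blast
  then have "T \<subseteq> A'" "{lo..hi} \<subseteq> J'" using assms(2,3) by auto
  with * show ?thesis unfolding has_blocked_set_def by blast
qed

lemma unavoidable_spaced:
  assumes "unavoidable s s' q a b c"
  obtains n where "\<And>pos lo hi A. \<lbrakk>finite A; n \<le> card A; \<forall>x\<in>A. pos x \<inter> {lo..hi} \<noteq> {};
      \<not> has_blocked_set s s' q pos {lo..hi} A\<rbrakk> \<Longrightarrow>
    \<exists>B. spaced k A B \<and> has_pattern pos {lo..hi} B a b c"
proof -
  obtain n where n: "\<And>pos lo hi A. finite A \<and> n \<le> card A \<and> (\<forall>x\<in>A. pos x \<inter> {lo..hi} \<noteq> {}) \<Longrightarrow>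
        has_blocked_set s s' q pos {lo..hi} A \<or> has_pattern pos {lo..hi} A a b c"
    using assms unfolding unavoidable_def by blast
  show ?thesis
  proof (rule that[of "n * (2 * k + 1)"])
    fix pos :: "nat \<Rightarrow> nat set" and lo hi :: nat and A :: "nat set"
    assume fin: "finite A" and card: "n * (2 * k + 1) \<le> card A"
      and meet: "\<forall>x\<in>A. pos x \<inter> {lo..hi} \<noteq> {}"
      and nb: "\<not> has_blocked_set s s' q pos {lo..hi} A"
    obtain B where B: "card B = n" "spaced k A B"
      using spaced_subset_exists[OF fin card] by blast
    then have "B \<subseteq> A" by (simp add: spaced_def)
    then have "finite B \<and> n \<le> card B \<and> (\<forall>x\<in>B. pos x \<inter> {lo..hi} \<noteq> {})"
      using fin meet B(1) finite_subset by blast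
    from n[OF this] have "has_pattern pos {lo..hi} B a b c"
      using nb has_blocked_set_mono[OF _ \<open>B \<subseteq> A\<close> order_refl] by blast
    with B(2) show "\<exists>B. spaced k A B \<and> has_pattern pos {lo..hi} B a b c" by blast
  qed
qed

lemma le_card_superset:
  assumes "a \<le> card S" "finite U" "S \<subseteq> U"
  shows "a \<le> card U"
  using assms card_mono order_trans by blast

lemma card_insert_le_Suc:
  assumes "finite U" "a \<le> card S" "S \<subseteq> U" "v \<in> U" "v \<notin> S"
  shows "Suc a \<le> card U"
proof -
  have "card (insert v S) \<le> card U" using assms by (intro card_mono) auto
  then show ?thesis using assms finite_subset by fastforce
qed

lemma linkedI:
  assumes "pos x \<inter> {lo..hi} \<noteq> {}" "pos y \<inter> {lo..hi} \<noteq> {}" "{lo..hi} \<subseteq> J"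
    "\<And>u. u \<in> Z \<Longrightarrow> pos u \<inter> {lo..hi} = {}"
  shows "linked pos J x y Z"
  using assms unfolding linked_def by blast

lemma has_patternI:
  assumes "x \<in> A" "y \<in> A" "U \<subseteq> A" "x < y" "linked pos J x y U" "a \<le> card {u\<in>U. u < x}"
    "b \<le> card {u\<in>U. x < u \<and> u < y}" "c \<le> card {u\<in>U. y < u}"
  shows "has_pattern pos J A a b c"
  using assms unfolding has_pattern_def by blast

text \<open>
  The central step. Take a pattern for \<open>(a, 0, c)\<close> in a spaced subset, realised on an interval
  \<open>Q\<close>, and the \<open>s\<close> letters \<open>V\<close> just below \<open>x\<close>. If \<open>Q\<close> misses a letter of \<open>V\<close>, that letter can be
  added to the avoided ones. Otherwise every letter of \<open>V\<close> occurs on \<open>Q\<close>; so either \<open>V\<close> is blocked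
  from below on \<open>Q\<close>, or two letters of \<open>V\<close> are linked inside \<open>Q\<close> avoiding a smaller one. As \<open>Q\<close>
  misses all letters of \<open>U\<close>, the latter is again a pattern, with one more letter below. Moving to
  letters below \<open>x\<close> loses the letters between \<open>x\<close> and \<open>y\<close>, whence the restriction to \<open>b = 0\<close>.
\<close>

lemma unavoidable_below:
  assumes "unavoidable s s' q a 0 c"
  shows "unavoidable s s' q (Suc a) 0 c"
proof -
  obtain n where n: "\<And>pos lo hi A. \<lbrakk>finite A; n \<le> card A; \<forall>x\<in>A. pos x \<inter> {lo..hi} \<noteq> {};
      \<not> has_blocked_set s s' q pos {lo..hi} A\<rbrakk> \<Longrightarrow>
    \<exists>B. spaced s A B \<and> has_pattern pos {lo..hi} B a 0 c"
    using unavoidable_spaced[OF assms, where k = s] by metis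
  show ?thesis
    unfolding unavoidable_def
  proof (intro exI[of _ n] allI impI, elim conjE, rule iffD2[OF disj_imp], rule impI)
    fix pos :: "nat \<Rightarrow> nat set" and lo hi :: nat and A :: "nat set"
    assume A: "finite A" "n \<le> card A" "\<forall>x\<in>A. pos x \<inter> {lo..hi} \<noteq> {}"
      and nb: "\<not> has_blocked_set s s' q pos {lo..hi} A"
    from n[OF A nb] obtain B x y U where B: "spaced s A B"
      and xy: "x \<in> B" "y \<in> B" "U \<subseteq> B" "x < y"
      and cards: "a \<le> card {u\<in>U. u < x}" "c \<le> card {u\<in>U. y < u}"
      and "linked pos {lo..hi} x y U"
      unfolding has_pattern_def by blast
    then obtain lo' hi' where J: "{lo'..hi'} \<subseteq> {lo..hi}"
      and meets: "pos x \<inter> {lo'..hi'} \<noteq> {}" "pos y \<inter> {lo'..hi'} \<noteq> {}"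
      and misses: "\<forall>u\<in>U. pos u \<inter> {lo'..hi'} = {}"
      unfolding linked_def by blast
    have "B \<subseteq> A" using B by (simp add: spaced_def)
    note xy = xy(1-3) this xy(4)
    obtain V where V: "V \<subseteq> A" "card V = s" "\<And>v. v \<in> V \<Longrightarrow> v < x"
      "\<And>v u. v \<in> V \<Longrightarrow> u \<in> B \<Longrightarrow> u < x \<Longrightarrow> u < v"
      using spaced_below[OF B xy(1)] by metis
    have finU: "finite U" using finite_subset[OF subset_trans[OF xy(3) xy(4)] A(1)] .
    show "has_pattern pos {lo..hi} A (Suc a) 0 c"
    proof (cases "\<exists>v\<in>V. pos v \<inter> {lo'..hi'} = {}")
      case True
      then obtain v where v: "v \<in> V" "pos v \<inter> {lo'..hi'} = {}" by blast
      have "v \<notin> U" using V(4)[OF v(1) _ V(3)[OF v(1)]] xy(3) by blast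
      show ?thesis
      proof (rule has_patternI[of x _ y "insert v U"])
        show "Suc a \<le> card {u \<in> insert v U. u < x}"
          using V v finU \<open>v \<notin> U\<close> by (intro card_insert_le_Suc[OF _ cards(1), of _ v]) auto
        show "c \<le> card {u \<in> insert v U. y < u}"
          using finU by (intro le_card_superset[OF cards(2)]) auto
        show "linked pos {lo..hi} x y (insert v U)"
          using meets J misses v by (intro linkedI) auto
      qed (use xy V v in auto)
    next
      case False
      have "\<not> lower_blocked pos {lo'..hi'} V"
        using nb False V J unfolding has_blocked_set_def by blast
      then obtain u' v v' where v: "u' \<in> V" "v \<in> V" "v' \<in> V" "u' < v" "v < v'"
          "linked pos {lo'..hi'} v v' {u'}"
        unfolding lower_blocked_def by blast
      then obtain lo'' hi'' where J': "{lo''..hi''} \<subseteq> {lo'..hi'}" "pos v \<inter> {lo''..hi''} \<noteq> {}"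
        "pos v' \<inter> {lo''..hi''} \<noteq> {}" "pos u' \<inter> {lo''..hi''} = {}"
        unfolding linked_def by blast
      have "u' \<notin> U" using V(4)[OF v(1) _ V(3)[OF v(1)]] xy(3) by blast
      show ?thesis
      proof (rule has_patternI[of v _ v' "insert u' U"])
        show "Suc a \<le> card {u \<in> insert u' U. u < v}"
          using V v finU \<open>u' \<notin> U\<close> xy by (intro card_insert_le_Suc[OF _ cards(1), of _ u']) auto
        show "c \<le> card {u \<in> insert u' U. v' < u}"
          using finU xy V(3)[OF v(3)] by (intro le_card_superset[OF cards(2)]) auto
        show "linked pos {lo..hi} v v' (insert u' U)"
          using J J' misses by (intro linkedI[of _ _ lo'' hi'']) blast+
      qed (use xy V v in auto)
    qed
  qed
qed

text \<open>
  Symmetrically, with the letters just above \<open>y\<close>.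
\<close>

lemma unavoidable_above:
  assumes "unavoidable s s' q a 0 c"
  shows "unavoidable s s' q a 0 (Suc c)"
proof -
  obtain n where n: "\<And>pos lo hi A. \<lbrakk>finite A; n \<le> card A; \<forall>x\<in>A. pos x \<inter> {lo..hi} \<noteq> {};
      \<not> has_blocked_set s s' q pos {lo..hi} A\<rbrakk> \<Longrightarrow>
    \<exists>B. spaced s A B \<and> has_pattern pos {lo..hi} B a 0 c"
    using unavoidable_spaced[OF assms, where k = s] by metis
  show ?thesis
    unfolding unavoidable_def
  proof (intro exI[of _ n] allI impI, elim conjE, rule iffD2[OF disj_imp], rule impI)
    fix pos :: "nat \<Rightarrow> nat set" and lo hi :: nat and A :: "nat set"
    assume A: "finite A" "n \<le> card A" "\<forall>x\<in>A. pos x \<inter> {lo..hi} \<noteq> {}"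
      and nb: "\<not> has_blocked_set s s' q pos {lo..hi} A"
    from n[OF A nb] obtain B x y U where B: "spaced s A B"
      and xy: "x \<in> B" "y \<in> B" "U \<subseteq> B" "x < y"
      and cards: "a \<le> card {u\<in>U. u < x}" "c \<le> card {u\<in>U. y < u}"
      and "linked pos {lo..hi} x y U"
      unfolding has_pattern_def by blast
    then obtain lo' hi' where J: "{lo'..hi'} \<subseteq> {lo..hi}"
      and meets: "pos x \<inter> {lo'..hi'} \<noteq> {}" "pos y \<inter> {lo'..hi'} \<noteq> {}"
      and misses: "\<forall>u\<in>U. pos u \<inter> {lo'..hi'} = {}"
      unfolding linked_def by blast
    have "B \<subseteq> A" using B by (simp add: spaced_def)
    note xy = xy(1-3) this xy(4)
    obtain V where V: "V \<subseteq> A" "card V = s" "\<And>v. v \<in> V \<Longrightarrow> y < v"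
      "\<And>v u. v \<in> V \<Longrightarrow> u \<in> B \<Longrightarrow> y < u \<Longrightarrow> v < u"
      using spaced_above[OF B xy(2)] by metis
    have finU: "finite U" using finite_subset[OF subset_trans[OF xy(3) xy(4)] A(1)] .
    show "has_pattern pos {lo..hi} A a 0 (Suc c)"
    proof (cases "\<exists>v\<in>V. pos v \<inter> {lo'..hi'} = {}")
      case True
      then obtain v where v: "v \<in> V" "pos v \<inter> {lo'..hi'} = {}" by blast
      have "v \<notin> U" using V(4)[OF v(1) _ V(3)[OF v(1)]] xy(3) by blast
      show ?thesis
      proof (rule has_patternI[of x _ y "insert v U"])
        show "Suc c \<le> card {u \<in> insert v U. y < u}"
          using V v finU \<open>v \<notin> U\<close> by (intro card_insert_le_Suc[OF _ cards(2), of _ v]) auto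
        show "a \<le> card {u \<in> insert v U. u < x}"
          using finU by (intro le_card_superset[OF cards(1)]) auto
        show "linked pos {lo..hi} x y (insert v U)"
          using meets J misses v by (intro linkedI) auto
      qed (use xy V v in auto)
    next
      case False
      have "\<not> upper_blocked pos {lo'..hi'} V"
        using nb False V J unfolding has_blocked_set_def by blast
      then obtain v v' u' where v: "v \<in> V" "v' \<in> V" "u' \<in> V" "v < v'" "v' < u'"
          "linked pos {lo'..hi'} v v' {u'}"
        unfolding upper_blocked_def by blast
      then obtain lo'' hi'' where J': "{lo''..hi''} \<subseteq> {lo'..hi'}" "pos v \<inter> {lo''..hi''} \<noteq> {}"
        "pos v' \<inter> {lo''..hi''} \<noteq> {}" "pos u' \<inter> {lo''..hi''} = {}"
        unfolding linked_def by blast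
      have "u' \<notin> U" using V(4)[OF v(3) _ V(3)[OF v(3)]] xy(3) by blast
      show ?thesis
      proof (rule has_patternI[of v _ v' "insert u' U"])
        show "Suc c \<le> card {u \<in> insert u' U. v' < u}"
          using V v finU \<open>u' \<notin> U\<close> xy by (intro card_insert_le_Suc[OF _ cards(2), of _ u']) auto
        show "a \<le> card {u \<in> insert u' U. u < v}"
          using finU xy V(3)[OF v(1)] by (intro le_card_superset[OF cards(1)]) auto
        show "linked pos {lo..hi} v v' (insert u' U)"
          using J J' misses by (intro linkedI[of _ _ lo'' hi'']) blast+
      qed (use xy V v in auto)
    qed
  qed
qed

text \<open>
  Here the letters just above \<open>x\<close> are used. If all of them occur on \<open>Q\<close> and they are not blocked,
  two of them are linked avoiding \<open>q\<close> letters between them, and \<open>b < q\<close>; the counts \<open>a\<close> and \<open>c\<close> are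
  kept because all letters of \<open>U\<close> below \<open>x\<close> or above \<open>y\<close> stay avoided.
\<close>

lemma unavoidable_between:
  assumes "unavoidable s s' q a b c" "b < q"
  shows "unavoidable s s' q a (Suc b) c"
proof -
  obtain n where n: "\<And>pos lo hi A. \<lbrakk>finite A; n \<le> card A; \<forall>x\<in>A. pos x \<inter> {lo..hi} \<noteq> {};
      \<not> has_blocked_set s s' q pos {lo..hi} A\<rbrakk> \<Longrightarrow>
    \<exists>B. spaced s' A B \<and> has_pattern pos {lo..hi} B a b c"
    using unavoidable_spaced[OF assms(1), where k = s'] by metis
  show ?thesis
    unfolding unavoidable_def
  proof (intro exI[of _ n] allI impI, elim conjE, rule iffD2[OF disj_imp], rule impI)
    fix pos :: "nat \<Rightarrow> nat set" and lo hi :: nat and A :: "nat set"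
    assume A: "finite A" "n \<le> card A" "\<forall>x\<in>A. pos x \<inter> {lo..hi} \<noteq> {}"
      and nb: "\<not> has_blocked_set s s' q pos {lo..hi} A"
    from n[OF A nb] obtain B x y U where B: "spaced s' A B"
      and xy: "x \<in> B" "y \<in> B" "U \<subseteq> B" "x < y"
      and cards: "a \<le> card {u\<in>U. u < x}" "b \<le> card {u\<in>U. x < u \<and> u < y}" "c \<le> card {u\<in>U. y < u}"
      and "linked pos {lo..hi} x y U"
      unfolding has_pattern_def by blast
    then obtain lo' hi' where J: "{lo'..hi'} \<subseteq> {lo..hi}"
      and meets: "pos x \<inter> {lo'..hi'} \<noteq> {}" "pos y \<inter> {lo'..hi'} \<noteq> {}"
      and misses: "\<forall>u\<in>U. pos u \<inter> {lo'..hi'} = {}"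
      unfolding linked_def by blast
    have "B \<subseteq> A" using B by (simp add: spaced_def)
    note xy = xy(1-3) this xy(4)
    obtain V where V: "V \<subseteq> A" "card V = s'" "\<And>v. v \<in> V \<Longrightarrow> x < v"
      "\<And>v u. v \<in> V \<Longrightarrow> u \<in> B \<Longrightarrow> x < u \<Longrightarrow> v < u"
      using spaced_above[OF B xy(1)] by metis
    have finU: "finite U" using finite_subset[OF subset_trans[OF xy(3) xy(4)] A(1)] .
    show "has_pattern pos {lo..hi} A a (Suc b) c"
    proof (cases "\<exists>v\<in>V. pos v \<inter> {lo'..hi'} = {}")
      case True
      then obtain v where v: "v \<in> V" "pos v \<inter> {lo'..hi'} = {}" by blast
      have "v \<notin> U" using V(4)[OF v(1) _ V(3)[OF v(1)]] xy(3) by blast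
      show ?thesis
      proof (rule has_patternI[of x _ y "insert v U"])
        show "Suc b \<le> card {u \<in> insert v U. x < u \<and> u < y}"
          using V v finU \<open>v \<notin> U\<close> xy by (intro card_insert_le_Suc[OF _ cards(2), of _ v]) auto
        show "a \<le> card {u \<in> insert v U. u < x}"
          using finU by (intro le_card_superset[OF cards(1)]) auto
        show "c \<le> card {u \<in> insert v U. y < u}"
          using finU by (intro le_card_superset[OF cards(3)]) auto
        show "linked pos {lo..hi} x y (insert v U)"
          using meets J misses v by (intro linkedI) auto
      qed (use xy V v in auto)
    next
      case False
      have "\<not> between_blocked q pos {lo'..hi'} V"
        using nb False V J unfolding has_blocked_set_def by blast
      then obtain v v' Z where v: "v \<in> V" "v' \<in> V" "Z \<subseteq> V" "v < v'" "card Z = q"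
          "\<And>z. z \<in> Z \<Longrightarrow> v < z \<and> z < v'" "linked pos {lo'..hi'} v v' Z"
        unfolding between_blocked_def by blast
      then obtain lo'' hi'' where J': "{lo''..hi''} \<subseteq> {lo'..hi'}" "pos v \<inter> {lo''..hi''} \<noteq> {}"
        "pos v' \<inter> {lo''..hi''} \<noteq> {}" "\<And>z. z \<in> Z \<Longrightarrow> pos z \<inter> {lo''..hi''} = {}"
        unfolding linked_def by blast
      have finZ: "finite Z" using finite_subset[OF subset_trans[OF v(3) V(1)] A(1)] .
      show ?thesis
      proof (rule has_patternI[of v _ v' "Z \<union> U"])
        have "Z \<subseteq> {u \<in> Z \<union> U. v < u \<and> u < v'}" using v by auto
        then have "card Z \<le> card {u \<in> Z \<union> U. v < u \<and> u < v'}"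
          using finZ finU by (intro card_mono) auto
        then show "Suc b \<le> card {u \<in> Z \<union> U. v < u \<and> u < v'}" using v(5) assms(2) by simp
        show "a \<le> card {u \<in> Z \<union> U. u < v}"
          using finU finZ xy V(3)[OF v(1)] by (intro le_card_superset[OF cards(1)]) auto
        have "v' < y" using V(4) v xy by blast
        then show "c \<le> card {u \<in> Z \<union> U. v' < u}"
          using finU finZ by (intro le_card_superset[OF cards(3)]) auto
        show "linked pos {lo..hi} v v' (Z \<union> U)"
          using J J' misses by (intro linkedI[of _ _ lo'' hi'']) blast+
      qed (use xy V v in auto)
    qed
  qed
qed

lemma unavoidable_0: "unavoidable s s' q 0 0 0"
  unfolding unavoidable_def
proof (intro exI[of _ 2] allI impI disjI2)
  fix pos :: "nat \<Rightarrow> nat set" and lo hi :: nat and A :: "nat set"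
  assume A: "finite A \<and> 2 \<le> card A \<and> (\<forall>x\<in>A. pos x \<inter> {lo..hi} \<noteq> {})"
  then obtain x y where "x \<in> A" "y \<in> A" "x \<noteq> y"
    by (metis card_le_Suc0_iff_eq not_less_eq_eq numeral_2_eq_2)
  then obtain x y where "x \<in> A" "y \<in> A" "x < y" by (metis linorder_neqE_nat)
  moreover have "linked pos {lo..hi} x y {}"
    using A calculation by (intro linkedI[of _ _ lo hi]) auto
  ultimately show "has_pattern pos {lo..hi} A 0 0 0"
    by (intro has_patternI[of x _ y "{}"]) auto
qed

text \<open>
  The order of the inductions matters: \<open>a\<close> and \<open>c\<close> can be raised only while \<open>b = 0\<close>.
\<close>

theorem unavoidable_pattern:
  assumes "b \<le> q"
  shows "unavoidable s s' q a b c"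
proof -
  have a: "unavoidable s s' q a 0 0"
    by (induction a) (simp_all add: unavoidable_0 unavoidable_below)
  have c: "unavoidable s s' q a 0 c"
    by (induction c) (simp_all add: a unavoidable_above)
  show ?thesis
    using assms by (induction b) (simp_all add: c unavoidable_between)
qed

section \<open>Mutually linked sets, by Ramsey's theorem\<close>

lemma ramsey_sets:
  fixes A :: "'a set"
  assumes "finite A" "ES k m n \<le> card A"
  shows "\<exists>H\<subseteq>A. card H = m \<and> (\<forall>X\<subseteq>H. card X = k \<longrightarrow> P X) \<or>
                card H = n \<and> (\<forall>X\<subseteq>H. card X = k \<longrightarrow> \<not> P X)"
proof -
  obtain g where "bij_betw g {0..<card A} A" using ex_bij_betw_nat_finite[OF assms(1)] by blast
  then have g: "inj_on g {..<ES k m n}" "g ` {..<ES k m n} \<subseteq> A"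
    using assms(2) by (auto simp: bij_betw_def intro: inj_on_subset)
  define f where "f X = (if P (g ` X) then 0 else 1 :: nat)" for X
  have "f \<in> nsets {..<ES k m n} k \<rightarrow> {..<length [m, n]}" by (auto simp: f_def)
  with ramsey2_full[of k m n] obtain i where i: "i < length [m, n]"
    and "monochromatic {..<ES k m n} ([m, n] ! i) k f i"
    unfolding partn_lst_def by blast
  then obtain H where H: "H \<subseteq> {..<ES k m n}" "finite H" "card H = [m, n] ! i"
    "f ` nsets H k \<subseteq> {i}"
    unfolding monochromatic_def nsets_def by blast
  have colour: "P X \<longleftrightarrow> i = 0" if X: "X \<subseteq> g ` H" "card X = k" for X
  proof -
    obtain Y where Y: "Y \<subseteq> H" "X = g ` Y" using X(1) by (meson subset_imageE)
    have "card Y = k"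
      using X(2) Y card_image[OF inj_on_subset[OF g(1)], of Y] H(1) by auto
    then have "Y \<in> nsets H k" using Y(1) H(2) finite_subset unfolding nsets_def by blast
    then have "f Y = i" using H(4) by blast
    then show ?thesis using Y(2) by (auto simp: f_def split: if_splits)
  qed
  have "card (g ` H) = [m, n] ! i"
    using card_image[OF inj_on_subset[OF g(1) H(1)]] H(3) by simp
  moreover have "g ` H \<subseteq> A" using g(2) H(1) by blast
  moreover have "i = 0 \<or> i = 1" using i by (simp add: less_Suc_eq)
  ultimately show ?thesis using colour by (intro exI[of _ "g ` H"]) auto
qed

text \<open>
  Ramsey's theorem for finitely many predicates on \<open>k\<close>-sets at once: either some \<open>k\<close>-set satisfies
  all of them, or one of them fails on all \<open>k\<close>-subsets of a large set.
\<close>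

lemma ramsey_predicates:
  assumes "finite I"
  shows "\<exists>N. \<forall>(\<Phi> :: 'i \<Rightarrow> 'a set \<Rightarrow> bool) A. finite A \<and> N \<le> card A \<longrightarrow>
    (\<exists>X\<subseteq>A. card X = k \<and> (\<forall>i\<in>I. \<Phi> i X)) \<or>
    (\<exists>H\<subseteq>A. card H = n \<and> (\<exists>i\<in>I. \<forall>X\<subseteq>H. card X = k \<longrightarrow> \<not> \<Phi> i X))"
  using assms
proof (induction I)
  case empty
  show ?case
    by (intro exI[of _ k] allI impI disjI1) (metis empty_iff obtain_subset_with_card_n)
next
  case (insert i I)
  obtain N where N: "\<And>(\<Phi> :: 'i \<Rightarrow> 'a set \<Rightarrow> bool) A. finite A \<and> N \<le> card A \<Longrightarrow>
    (\<exists>X\<subseteq>A. card X = k \<and> (\<forall>i\<in>I. \<Phi> i X)) \<or>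
    (\<exists>H\<subseteq>A. card H = n \<and> (\<exists>i\<in>I. \<forall>X\<subseteq>H. card X = k \<longrightarrow> \<not> \<Phi> i X))"
    using insert.IH by blast
  show ?case
  proof (intro exI[of _ "ES k N n"] allI impI, elim conjE)
    fix \<Phi> :: "'i \<Rightarrow> 'a set \<Rightarrow> bool" and A :: "'a set"
    assume A: "finite A" "ES k N n \<le> card A"
    from ramsey_sets[OF this, of "\<Phi> i"] obtain H where H: "H \<subseteq> A"
      "card H = N \<and> (\<forall>X\<subseteq>H. card X = k \<longrightarrow> \<Phi> i X) \<or>
       card H = n \<and> (\<forall>X\<subseteq>H. card X = k \<longrightarrow> \<not> \<Phi> i X)" by blast
    show "(\<exists>X\<subseteq>A. card X = k \<and> (\<forall>i\<in>insert i I. \<Phi> i X)) \<or>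
      (\<exists>H\<subseteq>A. card H = n \<and> (\<exists>i\<in>insert i I. \<forall>X\<subseteq>H. card X = k \<longrightarrow> \<not> \<Phi> i X))"
      using H(2)
    proof (elim disjE conjE)
      assume *: "card H = N" "\<forall>X\<subseteq>H. card X = k \<longrightarrow> \<Phi> i X"
      have "finite H \<and> N \<le> card H" using *(1) finite_subset[OF H(1) A(1)] by simp
      from N[OF this, of \<Phi>] show ?thesis
      proof (elim disjE exE conjE)
        fix X assume "X \<subseteq> H" "card X = k" "\<forall>i\<in>I. \<Phi> i X"
        then show ?thesis using * H(1) by (intro disjI1 exI[of _ X]) auto
      next
        fix H' assume "H' \<subseteq> H" "card H' = n" "\<exists>i\<in>I. \<forall>X\<subseteq>H'. card X = k \<longrightarrow> \<not> \<Phi> i X"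
        then show ?thesis using H(1) by (intro disjI2 exI[of _ H']) auto
      qed
    next
      assume "card H = n" "\<forall>X\<subseteq>H. card X = k \<longrightarrow> \<not> \<Phi> i X"
      then show ?thesis using H(1) by (intro disjI2 exI[of _ H]) auto
    qed
  qed
qed

text \<open>
  If one set \<open>X\<close> has this property on sufficiently many paths, then \<open>X\<close> is the set of branch vertices of a proper
  subdivision of a complete graph, each edge using a path of its own.
\<close>

definition mutually_linked :: "('b \<Rightarrow> nat set) \<Rightarrow> nat set \<Rightarrow> 'b set \<Rightarrow> bool" where
  "mutually_linked pos J X \<longleftrightarrow> (\<forall>x\<in>X. \<forall>y\<in>X. x \<noteq> y \<longrightarrow> linked pos J x y (X - {x, y}))"

text \<open>
  For each pair of ranks in a \<open>(q + 2)\<close>-set, consider the property that the two elements of these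
  ranks are linked avoiding the others; the ranks are encoded by the numbers of elements below and
  between the two. A set in which one of these properties always fails contains no pattern for
  the corresponding triple.
\<close>

lemma mutually_linked_or_pattern_free:
  "\<exists>N. \<forall>pos J A. finite A \<and> N \<le> card A \<longrightarrow>
     (\<exists>X\<subseteq>A. card X = q + 2 \<and> mutually_linked pos J X) \<or>
     (\<exists>H\<subseteq>A. card H = n \<and> (\<exists>a b c. a + b + c = q \<and> \<not> has_pattern pos J H a b c))"
proof -
  define I where "I = {(a, b). a + b \<le> q}"
  have "I \<subseteq> {..q} \<times> {..q}" by (auto simp: I_def)
  then have "finite I" by (rule finite_subset) auto
  from ramsey_predicates[OF this, of "q + 2" n] obtain N where
    N: "\<And>(\<Phi> :: nat \<times> nat \<Rightarrow> nat set \<Rightarrow> bool) A. finite A \<and> N \<le> card A \<Longrightarrow>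
    (\<exists>X\<subseteq>A. card X = q + 2 \<and> (\<forall>i\<in>I. \<Phi> i X)) \<or>
    (\<exists>H\<subseteq>A. card H = n \<and> (\<exists>i\<in>I. \<forall>X\<subseteq>H. card X = q + 2 \<longrightarrow> \<not> \<Phi> i X))"
    by blast
  show ?thesis
  proof (intro exI[of _ N] allI impI)
    fix pos :: "nat \<Rightarrow> nat set" and J A :: "nat set"
    assume A: "finite A \<and> N \<le> card A"
    define \<Phi> where "\<Phi> i X \<longleftrightarrow> (\<exists>x\<in>X. \<exists>y\<in>X. x < y \<and> card {u\<in>X. u < x} = fst i \<and>
      card {u\<in>X. x < u \<and> u < y} = snd i \<and> linked pos J x y (X - {x, y}))" for i X
    from N[OF A, of \<Phi>]
    show "(\<exists>X\<subseteq>A. card X = q + 2 \<and> mutually_linked pos J X) \<or>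
     (\<exists>H\<subseteq>A. card H = n \<and> (\<exists>a b c. a + b + c = q \<and> \<not> has_pattern pos J H a b c))"
    proof (elim disjE exE conjE)
      fix X assume X: "X \<subseteq> A" "card X = q + 2" "\<forall>i\<in>I. \<Phi> i X"
      have fin: "finite X" using X(1) A finite_subset by blast
      have mono: "card {u\<in>X. P u} < card {u\<in>X. Q u}"
        if "\<And>u. P u \<Longrightarrow> Q u" "z \<in> X" "Q z" "\<not> P z" for P Q z
        using fin that by (intro psubset_card_mono) auto
      have less: "linked pos J x y (X - {x, y})" if xy: "x \<in> X" "y \<in> X" "x < y" for x y
      proof -
        let ?a = "card {u\<in>X. u < x}" and ?b = "card {u\<in>X. x < u \<and> u < y}"
        have "?a + ?b = card ({u\<in>X. u < x} \<union> {u\<in>X. x < u \<and> u < y})"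
          using fin by (intro card_Un_disjoint[symmetric]) auto
        also have "\<dots> \<le> card (X - {x, y})" using fin xy by (intro card_mono) auto
        also have "\<dots> = q" using xy X(2) fin by (simp add: card_Diff_subset)
        finally have "\<Phi> (?a, ?b) X" using X(3) by (simp add: I_def)
        then obtain x' y' where *: "x' \<in> X" "y' \<in> X" "x' < y'" "card {u\<in>X. u < x'} = ?a"
          "card {u\<in>X. x' < u \<and> u < y'} = ?b" "linked pos J x' y' (X - {x', y'})"
          unfolding \<Phi>_def by auto
        \<comment> \<open>The numbers of elements below and between determine the pair.\<close>
        have "x' = x"
        proof (rule linorder_cases[of x x'])
          assume "x < x'"
          then have "?a < card {u\<in>X. u < x'}" using xy by (intro mono[of _ _ x]) auto
          then show ?thesis using * by simp
        next
          assume "x' < x"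
          then have "card {u\<in>X. u < x'} < ?a" using * by (intro mono[of _ _ x']) auto
          then show ?thesis using * by simp
        qed simp
        moreover have "y' = y"
        proof (rule linorder_cases[of y y'])
          assume "y < y'"
          then have "?b < card {u\<in>X. x' < u \<and> u < y'}"
            using xy \<open>x' = x\<close> by (intro mono[of _ _ y]) auto
          then show ?thesis using * by simp
        next
          assume "y' < y"
          then have "card {u\<in>X. x' < u \<and> u < y'} < ?b"
            using * \<open>x' = x\<close> by (intro mono[of _ _ y']) auto
          then show ?thesis using * by simp
        qed simp
        ultimately show ?thesis using * by simp
      qed
      have "mutually_linked pos J X"
        unfolding mutually_linked_def
      proof (intro ballI impI)
        fix x y assume "x \<in> X" "y \<in> X" "x \<noteq> y"
        then show "linked pos J x y (X - {x, y})"
          using less[of x y] less[of y x] linked_commute[of pos J x y] insert_commute[of x y "{}"]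
          by (metis linorder_neqE_nat)
      qed
      then show ?thesis using X by blast
    next
      fix H assume H: "H \<subseteq> A" "card H = n"
        "\<exists>i\<in>I. \<forall>X\<subseteq>H. card X = q + 2 \<longrightarrow> \<not> \<Phi> i X"
      then obtain a b where ab: "a + b \<le> q" "\<And>X. X \<subseteq> H \<Longrightarrow> card X = q + 2 \<Longrightarrow> \<not> \<Phi> (a, b) X"
        by (auto simp: I_def)
      have "\<not> has_pattern pos J H a b (q - a - b)"
      proof
        assume "has_pattern pos J H a b (q - a - b)"
        then obtain x y U where xy: "x \<in> H" "y \<in> H" "U \<subseteq> H" "x < y" "linked pos J x y U"
          and c: "a \<le> card {u\<in>U. u < x}" "b \<le> card {u\<in>U. x < u \<and> u < y}"
            "q - a - b \<le> card {u\<in>U. y < u}"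
          unfolding has_pattern_def by blast
        obtain Ua where Ua: "Ua \<subseteq> {u\<in>U. u < x}" "card Ua = a" "finite Ua"
          using obtain_subset_with_card_n[OF c(1)] by metis
        obtain Ub where Ub: "Ub \<subseteq> {u\<in>U. x < u \<and> u < y}" "card Ub = b" "finite Ub"
          using obtain_subset_with_card_n[OF c(2)] by metis
        obtain Uc where Uc: "Uc \<subseteq> {u\<in>U. y < u}" "card Uc = q - a - b" "finite Uc"
          using obtain_subset_with_card_n[OF c(3)] by metis
        define X where "X = insert x (insert y (Ua \<union> Ub \<union> Uc))"
        have "card (Ua \<union> Ub) = a + b"
          using Ua Ub xy(4) by (subst card_Un_disjoint) fastforce+
        then have "card (Ua \<union> Ub \<union> Uc) = q"
          using Ua Ub Uc xy(4) ab(1) by (subst card_Un_disjoint) fastforce+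
        moreover have "x \<notin> Ua \<union> Ub \<union> Uc" "y \<notin> Ua \<union> Ub \<union> Uc"
          using Ua(1) Ub(1) Uc(1) xy(4) by auto
        ultimately have "card X = q + 2" using xy(4) Ua Ub Uc by (simp add: X_def)
        moreover have "X \<subseteq> H" using xy Ua Ub Uc by (auto simp: X_def)
        moreover have "\<Phi> (a, b) X"
        proof -
          have "{u\<in>X. u < x} = Ua" using Ua(1) Ub(1) Uc(1) xy(4) by (auto simp: X_def)
          then have "card {u\<in>X. u < x} = fst (a, b)" using Ua by simp
          moreover have "{u\<in>X. x < u \<and> u < y} = Ub"
            using Ua(1) Ub(1) Uc(1) xy(4) by (auto simp: X_def)
          then have "card {u\<in>X. x < u \<and> u < y} = snd (a, b)" using Ub by simp
          moreover have "linked pos J x y (X - {x, y})"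
            using Ua(1) Ub(1) Uc(1) by (intro linked_mono[OF xy(5)]) (auto simp: X_def)
          moreover have "x \<in> X" "y \<in> X" by (auto simp: X_def)
          ultimately show ?thesis using xy(4) unfolding \<Phi>_def by blast
        qed
        ultimately show False using ab(2) by blast
      qed
      moreover have "a + b + (q - a - b) = q" using ab(1) by simp
      ultimately show ?thesis using H(1,2) by blast
    qed
  qed
qed

section \<open>The outcomes on a single path\<close>

text \<open>
  At most \<open>d\<close> consecutive vertices of the path contain a neighbour of \<open>x\<close> and one of \<open>y\<close>. Every route of
  length at most \<open>d + 1\<close> has at most \<open>d\<close> interior vertices and so makes its ends close.
\<close>

definition close :: "nat \<Rightarrow> ('b \<Rightarrow> nat set) \<Rightarrow> nat set \<Rightarrow> 'b \<Rightarrow> 'b \<Rightarrow> bool" where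
  "close d pos J x y \<longleftrightarrow> (\<exists>lo hi. {lo..hi} \<subseteq> J \<and> hi < lo + d \<and>
     pos x \<inter> {lo..hi} \<noteq> {} \<and> pos y \<inter> {lo..hi} \<noteq> {})"

lemma close_commute: "close d pos J x y \<longleftrightarrow> close d pos J y x"
  unfolding close_def by blast

text \<open>
  If no vertex of the path has \<open>r\<close> neighbours in \<open>A\<close>, an interval of \<open>d\<close> vertices meets at most
  \<open>d * r\<close> letters of \<open>A\<close> and therefore avoids many letters in each of the three ranges.
\<close>

lemma close_has_pattern:
  assumes fin: "finite A" and large: "2 * (2 * (q + d * r) + 1) \<le> card A"
    and close: "\<And>x y. x \<in> A \<Longrightarrow> y \<in> A \<Longrightarrow> x \<noteq> y \<Longrightarrow> close d pos J x y"
    and sparse: "\<And>k X. X \<subseteq> A \<Longrightarrow> card X = r \<Longrightarrow> \<exists>x\<in>X. k \<notin> pos x"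
    and abc: "a + b + c \<le> q"
  shows "has_pattern pos J A a b c"
proof -
  let ?k = "q + d * r"
  obtain B where B: "card B = 2" "spaced ?k A B" using spaced_subset_exists[OF fin large] by blast
  then obtain x y where "B = {x, y}" "x \<noteq> y" by (meson card_2_iff)
  then obtain x y where xy: "x \<in> B" "y \<in> B" "x < y" by (metis insertCI linorder_neqE_nat)
  have xyA: "x \<in> A" "y \<in> A" using xy B(2) by (auto simp: spaced_def)
  obtain Va where Va: "Va \<subseteq> A" "card Va = ?k" "\<And>v. v \<in> Va \<Longrightarrow> v < x"
    using spaced_below[OF B(2) xy(1)] by metis
  obtain Vb where Vb: "Vb \<subseteq> A" "card Vb = ?k" "\<And>v. v \<in> Vb \<Longrightarrow> x < v \<and> v < y"
    using spaced_above[OF B(2) xy(1)] xy(2,3) by metis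
  obtain Vc where Vc: "Vc \<subseteq> A" "card Vc = ?k" "\<And>v. v \<in> Vc \<Longrightarrow> y < v"
    using spaced_above[OF B(2) xy(2)] by metis
  obtain lo hi where J: "{lo..hi} \<subseteq> J" "hi < lo + d"
    and meet: "pos x \<inter> {lo..hi} \<noteq> {}" "pos y \<inter> {lo..hi} \<noteq> {}"
    using close[OF xyA] xy(3) unfolding close_def by blast
  define D where "D = {u\<in>A. pos u \<inter> {lo..hi} \<noteq> {}}"
  have "D = (\<Union>k\<in>{lo..hi}. {u\<in>A. k \<in> pos u})" by (auto simp: D_def)
  then have "card D \<le> (\<Sum>k\<in>{lo..hi}. card {u\<in>A. k \<in> pos u})" by (simp add: card_UN_le)
  also have "\<dots> \<le> (\<Sum>k\<in>{lo..hi}. r)"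
  proof (rule sum_mono, rule ccontr)
    fix k assume "\<not> card {u\<in>A. k \<in> pos u} \<le> r"
    then obtain X where "X \<subseteq> {u\<in>A. k \<in> pos u}" "card X = r"
      by (metis nat_le_linear obtain_subset_with_card_n)
    then show False using sparse[of X k] by blast
  qed
  also have "\<dots> = (Suc hi - lo) * r" by simp
  also have "\<dots> \<le> d * r" using J(2) by (intro mult_le_mono1) linarith
  finally have cD: "card D \<le> d * r" .
  have avoid: "q \<le> card (V - D)" if "V \<subseteq> A" "card V = ?k" for V
  proof -
    have "finite D" using fin by (simp add: D_def)
    then have "card V - card D \<le> card (V - D)" by (rule diff_card_le_card_Diff)
    then show ?thesis using cD that(2) by linarith
  qed
  have large: "e \<le> card {u\<in>A - D. P u}"
    if "V \<subseteq> A" "card V = ?k" "\<forall>v\<in>V. P v" "e \<le> q" for V P e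
  proof (rule le_card_superset[OF order_trans[OF that(4) avoid[OF that(1,2)]]])
    show "V - D \<subseteq> {u\<in>A - D. P u}" using that(1,3) by blast
  qed (use fin in simp)
  show ?thesis
  proof (rule has_patternI[of x _ y "A - D"])
    show "linked pos J x y (A - D)"
      using meet J by (intro linkedI[of _ _ lo hi]) (auto simp: D_def)
    show "a \<le> card {u\<in>A - D. u < x}" using Va abc by (intro large) auto
    show "b \<le> card {u\<in>A - D. x < u \<and> u < y}" using Vb abc by (intro large) auto
    show "c \<le> card {u\<in>A - D. y < u}" using Vc abc by (intro large) auto
  qed (use xy xyA in auto)
qed

text \<open>
  This lemma provides ampleness: by Ramsey's theorem for pairs it suffices to treat a set of pairwise
  close letters, and there every pattern occurs.
\<close>

lemma far_apart_subset:
  "\<exists>N. \<forall>pos J (A :: nat set). finite A \<and> N \<le> card A \<longrightarrow>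
     (\<exists>k X. X \<subseteq> A \<and> card X = r \<and> (\<forall>x\<in>X. k \<in> pos x)) \<or>
     (\<exists>X\<subseteq>A. card X = q + 2 \<and> mutually_linked pos J X) \<or>
     (\<exists>H\<subseteq>A. card H = n \<and> (\<forall>x\<in>H. \<forall>y\<in>H. x \<noteq> y \<longrightarrow> \<not> close d pos J x y))"
proof -
  obtain M where M: "\<And>pos J A. finite A \<and> M \<le> card A \<Longrightarrow>
     (\<exists>X\<subseteq>A. card X = q + 2 \<and> mutually_linked pos J X) \<or>
     (\<exists>H\<subseteq>A. card H = 2 * (2 * (q + d * r) + 1) \<and>
        (\<exists>a b c. a + b + c = q \<and> \<not> has_pattern pos J H a b c))"
    using mutually_linked_or_pattern_free[of q "2 * (2 * (q + d * r) + 1)"] by blast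
  show ?thesis
  proof (intro exI[of _ "ES 2 M n"] allI impI, elim conjE)
    fix pos :: "nat \<Rightarrow> nat set" and J A :: "nat set"
    assume A: "finite A" "ES 2 M n \<le> card A"
    from ramsey_sets[OF this, of "\<lambda>X. \<forall>x\<in>X. \<forall>y\<in>X. x \<noteq> y \<longrightarrow> close d pos J x y"]
    obtain H where H: "H \<subseteq> A" and
      "card H = M \<and> (\<forall>X\<subseteq>H. card X = 2 \<longrightarrow> (\<forall>x\<in>X. \<forall>y\<in>X. x \<noteq> y \<longrightarrow> close d pos J x y)) \<or>
       card H = n \<and> (\<forall>X\<subseteq>H. card X = 2 \<longrightarrow> \<not> (\<forall>x\<in>X. \<forall>y\<in>X. x \<noteq> y \<longrightarrow> close d pos J x y))"
      by blast
    then consider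
      (close) "card H = M" "\<And>X. X \<subseteq> H \<Longrightarrow> card X = 2 \<Longrightarrow> \<forall>x\<in>X. \<forall>y\<in>X. x \<noteq> y \<longrightarrow> close d pos J x y"
    | (far) "card H = n" "\<And>X. X \<subseteq> H \<Longrightarrow> card X = 2 \<Longrightarrow> \<not> (\<forall>x\<in>X. \<forall>y\<in>X. x \<noteq> y \<longrightarrow> close d pos J x y)"
      by blast
    then show "(\<exists>k X. X \<subseteq> A \<and> card X = r \<and> (\<forall>x\<in>X. k \<in> pos x)) \<or>
     (\<exists>X\<subseteq>A. card X = q + 2 \<and> mutually_linked pos J X) \<or>
     (\<exists>H\<subseteq>A. card H = n \<and> (\<forall>x\<in>H. \<forall>y\<in>H. x \<noteq> y \<longrightarrow> \<not> close d pos J x y))"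
    proof cases
      case close
      have "finite H \<and> M \<le> card H" using finite_subset[OF H A(1)] close(1) by simp
      from M[OF this, of pos J] show ?thesis
      proof (elim disjE exE conjE)
        fix X assume "X \<subseteq> H" "card X = q + 2" "mutually_linked pos J X"
        then show ?thesis using H by (intro disjI2 disjI1 exI[of _ X]) auto
      next
        fix H' a b c assume H': "H' \<subseteq> H" "card H' = 2 * (2 * (q + d * r) + 1)"
          and abc: "a + b + c = q" "\<not> has_pattern pos J H' a b c"
        have "\<exists>k X. X \<subseteq> A \<and> card X = r \<and> (\<forall>x\<in>X. k \<in> pos x)"
        proof (rule ccontr)
          assume "\<not> (\<exists>k X. X \<subseteq> A \<and> card X = r \<and> (\<forall>x\<in>X. k \<in> pos x))"
          then have "\<exists>x\<in>X. k \<notin> pos x" if "X \<subseteq> H'" "card X = r" for k X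
            using that subset_trans[OF that(1) subset_trans[OF H'(1) H]] by blast
          moreover have "close d pos J x y" if "x \<in> H'" "y \<in> H'" "x \<noteq> y" for x y
            using close(2)[of "{x, y}"] that H'(1) by auto
          ultimately have "has_pattern pos J H' a b c"
            using finite_subset[OF subset_trans[OF H'(1) H] A(1)] H'(2) abc(1)
            by (intro close_has_pattern[of _ q d r]) auto
          then show False using abc(2) by blast
        qed
        then show ?thesis by (rule disjI1)
      qed
    next
      case far
      have "\<not> close d pos J x y" if "x \<in> H" "y \<in> H" "x \<noteq> y" for x y
        using far(2)[of "{x, y}"] that close_commute[of d pos J x y] by auto
      then show ?thesis using far(1) H by (intro disjI2 exI[of _ H]) auto
    qed
  qed
qed

theorem single_path_outcomes:
  "\<exists>N. \<forall>pos m A. finite A \<and> N \<le> card A \<and> (\<forall>x\<in>A. pos x \<inter> {0..m} \<noteq> {}) \<longrightarrow>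
     (\<exists>k X. X \<subseteq> A \<and> card X = r \<and> (\<forall>x\<in>X. k \<in> pos x)) \<or>
     (\<exists>X\<subseteq>A. card X = q + 2 \<and> mutually_linked pos {0..m} X) \<or>
     (\<exists>H\<subseteq>A. (\<forall>x\<in>H. \<forall>y\<in>H. x \<noteq> y \<longrightarrow> \<not> close d pos {0..m} x y) \<and>
        has_blocked_set s s' q pos {0..m} H)"
proof -
  have "\<exists>n. \<forall>pos lo hi A. finite A \<and> n \<le> card A \<and> (\<forall>x\<in>A. pos x \<inter> {lo..hi} \<noteq> {}) \<longrightarrow>
        has_blocked_set s s' q pos {lo..hi} A \<or> has_pattern pos {lo..hi} A a b c"
    if "a + b + c = q" for a b c
    using unavoidable_pattern[of b q s s' a c] that unfolding unavoidable_def by simp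
  then obtain f where f: "\<And>a b c pos lo hi A. a + b + c = q \<Longrightarrow>
       finite A \<and> f a b c \<le> card A \<and> (\<forall>x\<in>A. pos x \<inter> {lo..hi} \<noteq> {}) \<Longrightarrow>
        has_blocked_set s s' q pos {lo..hi} A \<or> has_pattern pos {lo..hi} A a b c"
    by metis
  \<comment> \<open>A crude common bound for the finitely many patterns.\<close>
  define n where "n = (\<Sum>a\<le>q. \<Sum>b\<le>q. \<Sum>c\<le>q. f a b c)"
  have n: "f a b c \<le> n" if "a + b + c = q" for a b c
  proof -
    have "f a b c \<le> (\<Sum>c\<le>q. f a b c)" using that by (intro member_le_sum) auto
    also have "\<dots> \<le> (\<Sum>b\<le>q. \<Sum>c\<le>q. f a b c)"
      using that by (intro member_le_sum[where f = "\<lambda>b. \<Sum>c\<le>q. f a b c"]) auto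
    also have "\<dots> \<le> n"
      unfolding n_def using that
      by (intro member_le_sum[where f = "\<lambda>a. \<Sum>b\<le>q. \<Sum>c\<le>q. f a b c"]) auto
    finally show ?thesis .
  qed
  obtain M where M: "\<And>pos J A. finite A \<and> M \<le> card A \<Longrightarrow>
     (\<exists>X\<subseteq>A. card X = q + 2 \<and> mutually_linked pos J X) \<or>
     (\<exists>H\<subseteq>A. card H = n \<and> (\<exists>a b c. a + b + c = q \<and> \<not> has_pattern pos J H a b c))"
    using mutually_linked_or_pattern_free[of q n] by blast
  obtain N where N: "\<And>pos J (A :: nat set). finite A \<and> N \<le> card A \<Longrightarrow>
     (\<exists>k X. X \<subseteq> A \<and> card X = r \<and> (\<forall>x\<in>X. k \<in> pos x)) \<or>
     (\<exists>X\<subseteq>A. card X = q + 2 \<and> mutually_linked pos J X) \<or>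
     (\<exists>H\<subseteq>A. card H = M \<and> (\<forall>x\<in>H. \<forall>y\<in>H. x \<noteq> y \<longrightarrow> \<not> close d pos J x y))"
    using far_apart_subset[of r q M d] by blast
  show ?thesis
  proof (intro exI[of _ N] allI impI)
    fix pos :: "nat \<Rightarrow> nat set" and m and A :: "nat set"
    assume A: "finite A \<and> N \<le> card A \<and> (\<forall>x\<in>A. pos x \<inter> {0..m} \<noteq> {})"
    then have "finite A \<and> N \<le> card A" by blast
    from N[OF this, of pos "{0..m}"]
    consider (1) "\<exists>k X. X \<subseteq> A \<and> card X = r \<and> (\<forall>x\<in>X. k \<in> pos x)"
      | (2) "\<exists>X\<subseteq>A. card X = q + 2 \<and> mutually_linked pos {0..m} X"
      | (3) H where "H \<subseteq> A" "card H = M"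
          "\<forall>x\<in>H. \<forall>y\<in>H. x \<noteq> y \<longrightarrow> \<not> close d pos {0..m} x y"
      by blast
    then show "(\<exists>k X. X \<subseteq> A \<and> card X = r \<and> (\<forall>x\<in>X. k \<in> pos x)) \<or>
     (\<exists>X\<subseteq>A. card X = q + 2 \<and> mutually_linked pos {0..m} X) \<or>
     (\<exists>H\<subseteq>A. (\<forall>x\<in>H. \<forall>y\<in>H. x \<noteq> y \<longrightarrow> \<not> close d pos {0..m} x y) \<and>
        has_blocked_set s s' q pos {0..m} H)"
    proof cases
      case 3
      have finH: "finite H" using finite_subset[OF 3(1)] A by simp
      then have "finite H \<and> M \<le> card H" using 3(2) by simp
      from M[OF this, of pos "{0..m}"] show ?thesis
      proof (elim disjE exE conjE)
        fix X assume "X \<subseteq> H" "card X = q + 2" "mutually_linked pos {0..m} X"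
        then show ?thesis using 3(1) by (intro disjI2 disjI1 exI[of _ X]) auto
      next
        fix H' a b c assume H': "H' \<subseteq> H" "card H' = n"
          and abc: "a + b + c = q" "\<not> has_pattern pos {0..m} H' a b c"
        have "finite H' \<and> f a b c \<le> card H' \<and> (\<forall>x\<in>H'. pos x \<inter> {0..m} \<noteq> {})"
          using n[OF abc(1)] H' 3(1) A finite_subset[OF H'(1) finH] by auto
        from f[OF abc(1) this] have "has_blocked_set s s' q pos {0..m} H"
          using abc(2) has_blocked_set_mono[OF _ H'(1) order_refl] by blast
        then show ?thesis using 3 by (intro disjI2 exI[of _ H]) auto
      qed
    qed (simp_all only: simp_thms)
  qed
qed

section \<open>Induced subgraphs\<close>

lemma pair_graph_sym: "pair_graph G \<Longrightarrow> (u, v) \<in> parcs G \<Longrightarrow> (v, u) \<in> parcs G"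
  by (rule pair_sym_digraph.arcs_symmetric) (simp_all add: pair_graph_def pair_pseudo_graph_def)

lemma pair_graph_no_loop: "pair_graph G \<Longrightarrow> (u, u) \<notin> parcs G"
  using pair_loopfree_digraph.pair_no_loops[of G "(u, u)"]
  by (auto simp: pair_graph_def pair_digraph_def)

lemma pair_graph_arc_verts:
  assumes "pair_graph G" "(u, v) \<in> parcs G"
  shows "u \<in> pverts G" "v \<in> pverts G"
proof -
  interpret pair_graph G by fact
  show "u \<in> pverts G" "v \<in> pverts G"
    using arc_fst_in_verts[OF assms(2)] arc_snd_in_verts[OF assms(2)] by simp_all
qed

text \<open>
  The subgraph of \<open>G\<close> induced on \<open>V\<close>; it is used for \<open>V\<close> contained in the vertex set of \<open>G\<close> only.
\<close>

definition induce :: "'a pair_pre_digraph \<Rightarrow> 'a set \<Rightarrow> 'a pair_pre_digraph" where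
  "induce G V = \<lparr>pverts = V, parcs = parcs G \<inter> V \<times> V\<rparr>"

lemma induce_simps [simp]:
  "pverts (induce G V) = V" "parcs (induce G V) = parcs G \<inter> V \<times> V"
  by (simp_all add: induce_def)

lemma pair_graph_induce:
  assumes "pair_graph G" "V \<subseteq> pverts G"
  shows "pair_graph (induce G V)"
proof -
  interpret pair_graph G by fact
  have "finite V" using assms(2) pair_finite_verts finite_subset by blast
  then show ?thesis
    using pair_finite_arcs assms(1) pair_graph_no_loop[OF assms(1)]
    by unfold_locales (auto simp: symmetric_def intro!: symI dest: pair_graph_sym)
qed

lemma induced_subgraph_induce:
  assumes "pair_graph G" "V \<subseteq> pverts G"
  shows "induced_subgraph (with_proj (induce G V)) (with_proj G)"
proof -
  interpret G: pair_graph G by fact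
  interpret H: pair_graph "induce G V" by (rule pair_graph_induce[OF assms])
  show ?thesis
    using assms(2) G.wf_digraph H.wf_digraph
    by (auto simp: induced_subgraph_def subgraph_def compatible_def)
qed

section \<open>Components\<close>

text \<open>
  Reachability in \<open>G\<close> with \<open>S\<close> deleted. It is reflexive on the remaining vertices only, so its field
  is \<open>pverts G - S\<close>.
\<close>

definition reach :: "'a pair_pre_digraph \<Rightarrow> 'a set \<Rightarrow> ('a \<times> 'a) set" where
  "reach G S = rtrancl_on (pverts G - S) (parcs G \<inter> (pverts G - S) \<times> (pverts G - S))"

lemma in_comps_iff:
  "L \<in> comps G S \<longleftrightarrow> L \<noteq> {} \<and> (\<forall>u\<in>L. \<forall>v\<in>L. (u, v) \<in> reach G S) \<and>
     (\<forall>u\<in>L. \<forall>v. v \<notin> L \<longrightarrow> (u, v) \<notin> reach G S \<or> (v, u) \<notin> reach G S)"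
proof -
  let ?W = "pverts G - S"
  have "arcs_ends (with_proj G \<restriction> ?W) = parcs G \<inter> ?W \<times> ?W"
    by (auto simp: arcs_ends_def arc_to_ends_def induce_subgraph_def image_iff)
  moreover have "verts (with_proj G \<restriction> ?W) = ?W" by (simp add: induce_subgraph_def)
  ultimately have "reachable (with_proj G \<restriction> ?W) u v \<longleftrightarrow> (u, v) \<in> reach G S" for u v
    by (simp add: reachable_def reach_def)
  then show ?thesis unfolding comps_def pre_digraph.sccs_verts_def by simp
qed

lemma reach_trans: "(u, v) \<in> reach G S \<Longrightarrow> (v, w) \<in> reach G S \<Longrightarrow> (u, w) \<in> reach G S"
  unfolding reach_def by (rule rtrancl_on_trans)

lemma comps_subset: "L \<in> comps G S \<Longrightarrow> L \<subseteq> pverts G - S"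
  unfolding in_comps_iff reach_def using in_rtrancl_on_in_F by fast

lemma comps_nonempty: "L \<in> comps G S \<Longrightarrow> L \<noteq> {}"
  unfolding in_comps_iff by blast

lemma comps_eq:
  assumes "L \<in> comps G S" "L' \<in> comps G S" "u \<in> L" "u \<in> L'"
  shows "L = L'"
  using assms unfolding in_comps_iff by (meson subsetI subset_antisym)

lemma arc_reach:
  assumes "pair_graph G" "(u, v) \<in> parcs G" "u \<notin> S" "v \<notin> S"
  shows "(u, v) \<in> reach G S"
  unfolding reach_def using assms pair_graph_arc_verts[OF assms(1,2)]
  by (auto intro!: rtrancl_on_into_rtrancl_on[of u u])

lemma comps_no_arc:
  assumes "pair_graph G" "L \<in> comps G S" "L' \<in> comps G S" "u \<in> L" "v \<in> L'" "(u, v) \<in> parcs G"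
  shows "L = L'"
proof -
  have "u \<notin> S" "v \<notin> S" using comps_subset assms by blast+
  then have "(u, v) \<in> reach G S" "(v, u) \<in> reach G S"
    using arc_reach[OF assms(1)] pair_graph_sym[OF assms(1)] assms(6) by blast+
  then have "v \<in> L" using assms(2,4) unfolding in_comps_iff by blast
  then show ?thesis using comps_eq assms by metis
qed

text \<open>
  The components are recognised as the cells of a partition into connected sets closed under
  adjacency.
\<close>

lemma comps_eqI:
  assumes cover: "\<Union>\<Q> = pverts G - S" and ne: "\<And>Q. Q \<in> \<Q> \<Longrightarrow> Q \<noteq> {}"
    and conn: "\<And>Q u v. Q \<in> \<Q> \<Longrightarrow> u \<in> Q \<Longrightarrow> v \<in> Q \<Longrightarrow> (u, v) \<in> reach G S"
    and sep: "\<And>Q u v. Q \<in> \<Q> \<Longrightarrow> u \<in> Q \<Longrightarrow> (u, v) \<in> parcs G \<Longrightarrow> v \<notin> S \<Longrightarrow> v \<in> Q"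
  shows "comps G S = \<Q>"
proof -
  have closed: "v \<in> Q" if "(u, v) \<in> reach G S" "u \<in> Q" "Q \<in> \<Q>" for u v Q
    using that(1) unfolding reach_def
  proof (induction rule: rtrancl_on_induct)
    case base
    show ?case by (rule that(2))
  next
    case (step y z)
    then show ?case using sep[OF that(3) step.IH] by blast
  qed
  have sub: "Q \<in> comps G S" if "Q \<in> \<Q>" for Q
    unfolding in_comps_iff using that ne conn closed by blast
  show ?thesis
  proof (intro equalityI subsetI)
    fix L assume L: "L \<in> comps G S"
    then obtain u where u: "u \<in> L" using comps_nonempty by blast
    then have "u \<in> pverts G - S" using comps_subset[OF L] by blast
    then obtain Q where "Q \<in> \<Q>" "u \<in> Q" using cover by blast
    then show "L \<in> \<Q>" using comps_eq[OF L sub u] by blast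
  qed (use sub in blast)
qed

section \<open>Induced paths\<close>

lemma set_vwalk_arcs: "set (vwalk_arcs p) = {(p ! i, p ! Suc i) |i. Suc i < length p}"
proof (induction p rule: vwalk_arcs.induct)
  case (3 x y xs)
  have "{((x # y # xs) ! i, (x # y # xs) ! Suc i) |i. Suc i < length (x # y # xs)} =
      insert (x, y) {((y # xs) ! i, (y # xs) ! Suc i) |i. Suc i < length (y # xs)}"
    (is "?L = ?R")
  proof
    show "?L \<subseteq> ?R"
    proof
      fix e assume "e \<in> ?L"
      then obtain i where "e = ((x # y # xs) ! i, (x # y # xs) ! Suc i)" "Suc i < length (x # y # xs)"
        by blast
      then show "e \<in> ?R" by (cases i) auto
    qed
    show "?R \<subseteq> ?L"
    proof
      fix e assume "e \<in> ?R"
      then consider "e = (x, y)" | i where "e = ((y # xs) ! i, (y # xs) ! Suc i)" "Suc i < length (y # xs)"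
        by blast
      then show "e \<in> ?L"
      proof cases
        case 1 then show ?thesis by (auto intro!: exI[of _ 0])
      next
        case 2 then show ?thesis by (auto intro!: exI[of _ "Suc i"])
      qed
    qed
  qed
  then show ?case using 3 by simp
qed auto

lemma induced_path_iff:
  assumes "pair_graph G"
  shows "induced_path G p \<longleftrightarrow> p \<noteq> [] \<and> distinct p \<and> set p \<subseteq> pverts G \<and>
    (\<forall>i<length p. \<forall>j<length p. (p ! i, p ! j) \<in> parcs G \<longleftrightarrow> j = Suc i \<or> i = Suc j)"
    (is "_ \<longleftrightarrow> ?R")
proof
  assume p: "induced_path G p"
  then have 1: "p \<noteq> []" "distinct p" "set p \<subseteq> pverts G" "set (vwalk_arcs p) \<subseteq> parcs G"
    and 2: "\<And>i j. i < j \<Longrightarrow> j < length p \<Longrightarrow> (p ! i, p ! j) \<in> parcs G \<Longrightarrow> j = Suc i"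
    by (auto simp: induced_path_def vpath_def vwalk_def)
  have 3: "(p ! i, p ! Suc i) \<in> parcs G" if "Suc i < length p" for i
    using 1(4) that by (auto simp: set_vwalk_arcs)
  have "(p ! i, p ! j) \<in> parcs G \<longleftrightarrow> j = Suc i \<or> i = Suc j" if "i < length p" "j < length p" for i j
    using 2[of i j] 2[of j i] 3[of i] 3[of j] that pair_graph_sym[OF assms] pair_graph_no_loop[OF assms]
    by (metis linorder_neqE_nat)
  with 1 show ?R by blast
next
  assume ?R
  then show "induced_path G p"
    by (auto simp: induced_path_def vpath_def vwalk_def set_vwalk_arcs)
qed

lemma induced_path_rev:
  assumes "pair_graph G" "induced_path G p"
  shows "induced_path G (rev p)"
proof -
  have p: "p \<noteq> []" "distinct p" "set p \<subseteq> pverts G"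
    "\<And>i j. i < length p \<Longrightarrow> j < length p \<Longrightarrow> (p ! i, p ! j) \<in> parcs G \<longleftrightarrow> j = Suc i \<or> i = Suc j"
    using assms(2) unfolding induced_path_iff[OF assms(1)] by blast+
  have "(rev p ! i, rev p ! j) \<in> parcs G \<longleftrightarrow> j = Suc i \<or> i = Suc j"
    if ij: "i < length p" "j < length p" for i j
  proof -
    have "(rev p ! i, rev p ! j) \<in> parcs G \<longleftrightarrow>
        length p - Suc j = Suc (length p - Suc i) \<or> length p - Suc i = Suc (length p - Suc j)"
      using ij by (simp add: rev_nth p(4))
    also have "\<dots> \<longleftrightarrow> j = Suc i \<or> i = Suc j" using ij by linarith
    finally show ?thesis .
  qed
  then show ?thesis unfolding induced_path_iff[OF assms(1)] using p(1-3) by simp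
qed

lemma induced_path_Cons:
  assumes "pair_graph G" "induced_path G p" "x \<in> pverts G" "x \<notin> set p"
    and "\<And>k. k < length p \<Longrightarrow> (x, p ! k) \<in> parcs G \<longleftrightarrow> k = 0"
  shows "induced_path G (x # p)"
proof -
  have p: "p \<noteq> []" "distinct p" "set p \<subseteq> pverts G"
    "\<And>i j. i < length p \<Longrightarrow> j < length p \<Longrightarrow> (p ! i, p ! j) \<in> parcs G \<longleftrightarrow> j = Suc i \<or> i = Suc j"
    using assms(2) unfolding induced_path_iff[OF assms(1)] by blast+
  have "(p ! k, x) \<in> parcs G \<longleftrightarrow> k = 0" if "k < length p" for k
    using assms(5)[OF that] pair_graph_sym[OF assms(1)] by blast
  then have "((x # p) ! i, (x # p) ! j) \<in> parcs G \<longleftrightarrow> j = Suc i \<or> i = Suc j"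
    if "i < length (x # p)" "j < length (x # p)" for i j
    using that assms(5) p(4) pair_graph_no_loop[OF assms(1)]
    by (cases i; cases j) auto
  then show ?thesis
    unfolding induced_path_iff[OF assms(1)] using p(1-3) assms(3,4) by auto
qed

lemma induced_path_slice:
  assumes "pair_graph G" "induced_path G p" "a \<le> b" "b < length p"
  shows "induced_path G (map ((!) p) [a..<Suc b])"
  using assms(2-4) unfolding induced_path_iff[OF assms(1)]
  by (auto simp: distinct_map inj_on_def nth_eq_iff_index_eq simp del: upt_Suc)

lemma induced_path_arc:
  assumes "pair_graph G" "induced_path G p" "u \<in> set p" "v \<in> set p" "(u, v) \<in> parcs G"
  shows "(u, v) \<in> set (vwalk_arcs p) \<or> (u, v) \<in> set (vwalk_arcs (rev p))"
proof -
  obtain i j where ij: "i < length p" "u = p ! i" "j < length p" "v = p ! j"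
    using assms(3,4) by (metis in_set_conv_nth)
  then have "j = Suc i \<or> i = Suc j"
    using assms(2,5) unfolding induced_path_iff[OF assms(1)] by blast
  then show ?thesis
  proof
    assume "j = Suc i"
    then show ?thesis using ij by (auto simp: set_vwalk_arcs)
  next
    assume "i = Suc j"
    then have "Suc (length p - Suc i) < length p"
      "length p - Suc (length p - Suc i) = i" "length p - Suc (Suc (length p - Suc i)) = j"
      using ij by linarith+
    then have "rev p ! (length p - Suc i) = u" "rev p ! Suc (length p - Suc i) = v"
      "Suc (length p - Suc i) < length p"
      using ij by (simp_all add: rev_nth)
    then show ?thesis unfolding set_vwalk_arcs length_rev by blast
  qed
qed

lemma induced_path_arcs_subset:
  assumes "induced_path G p"
  shows "set (vwalk_arcs p) \<subseteq> parcs G"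
  using assms by (auto simp: induced_path_def vpath_def vwalk_def)

lemma interior_rev: "interior (rev p) = interior p"
  unfolding interior_def by (metis butlast_rev butlast_tl rev_rev_ident set_rev tl_rev butlast_tl)

lemma set_interior:
  assumes "2 \<le> length p"
  shows "set p = {hd p, last p} \<union> interior p"
proof -
  obtain x q where "p = x # q" "q \<noteq> []" using assms by (cases p rule: vwalk_arcs.cases) auto
  moreover then obtain m y where "q = m @ [y]" by (metis rev_exhaust)
  ultimately show ?thesis by (auto simp: interior_def)
qed

section \<open>Routes and linked letters\<close>

text \<open>
  The indices of the neighbours of \<open>x\<close> on the path \<open>p\<close>.
\<close>

definition positions :: "'a pair_pre_digraph \<Rightarrow> 'a list \<Rightarrow> 'a \<Rightarrow> nat set" where
  "positions G p x = {k. k < length p \<and> (x, p ! k) \<in> parcs G}"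

text \<open>
  The case where the neighbour of \<open>x\<close> precedes that of \<open>y\<close> and both are unique in the interval.
\<close>

lemma linked_imp_path_aux:
  assumes G: "pair_graph G" and p: "induced_path G p" and xy: "x \<noteq> y" "x \<notin> set p" "y \<notin> set p"
    "(x, y) \<notin> parcs G"
    and ab: "a \<le> b" "a \<in> positions G p x" "b \<in> positions G p y"
    and uniq: "\<And>k. k \<in> {a..b} \<Longrightarrow> k \<in> positions G p x \<Longrightarrow> k = a"
      "\<And>k. k \<in> {a..b} \<Longrightarrow> k \<in> positions G p y \<Longrightarrow> k = b"
  shows "\<exists>R. induced_path G R \<and> hd R = x \<and> last R = y \<and> 3 \<le> length R \<and> interior R = (!) p ` {a..b}"
proof -
  let ?m = "map ((!) p) [a..<Suc b]"
  have len: "a < length p" "b < length p" using ab by (auto simp: positions_def)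
  have sub: "set ?m \<subseteq> set p" using len by auto
  have xG: "x \<in> pverts G" "y \<in> pverts G"
    using ab(2,3) pair_graph_arc_verts[OF G] by (auto simp: positions_def)
  have m: "induced_path G ?m" by (rule induced_path_slice[OF G p ab(1) len(2)])
  have mk: "?m ! k = p ! (a + k)" if "k < length ?m" for k
    using that by (simp del: upt_Suc)
  have lm: "length ?m = Suc b - a" by (simp del: upt_Suc)
  have x: "induced_path G (x # ?m)"
  proof (rule induced_path_Cons[OF G m xG(1)])
    show "x \<notin> set ?m" using sub xy by blast
    fix k assume k: "k < length ?m"
    then have "a + k \<in> {a..b}" "a + k < length p" using len unfolding lm by auto
    then show "(x, ?m ! k) \<in> parcs G \<longleftrightarrow> k = 0"
      using mk[OF k] uniq(1)[of "a + k"] ab(2) by (auto simp: positions_def)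
  qed
  have "induced_path G (y # rev (x # ?m))"
  proof (rule induced_path_Cons[OF G induced_path_rev[OF G x] xG(2)])
    show "y \<notin> set (rev (x # ?m))" using sub xy by auto
    fix k assume k: "k < length (rev (x # ?m))"
    show "(y, rev (x # ?m) ! k) \<in> parcs G \<longleftrightarrow> k = 0"
    proof (cases "k = length ?m")
      case True
      then have "rev (x # ?m) ! k = x" by (simp add: nth_append)
      moreover have "(y, x) \<notin> parcs G" using xy(4) pair_graph_sym[OF G] by blast
      moreover have "k \<noteq> 0" using True ab(1) by simp
      ultimately show ?thesis by simp
    next
      case False
      then have k': "k < length ?m" using k by simp
      then have "rev (x # ?m) ! k = rev ?m ! k" by (simp add: nth_append)
      also have "\<dots> = ?m ! (length ?m - Suc k)" using k' by (simp only: rev_nth)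
      also have "\<dots> = p ! (a + (length ?m - Suc k))" using k' by (intro mk) simp
      also have "a + (length ?m - Suc k) = b - k" using k' ab(1) unfolding lm by linarith
      finally have "rev (x # ?m) ! k = p ! (b - k)" .
      moreover have "b - k \<in> {a..b}" "b - k < length p" using k' len unfolding lm by auto
      moreover have "b - k = b \<longleftrightarrow> k = 0" using k' ab(1) unfolding lm by auto
      ultimately show ?thesis
        using uniq(2)[of "b - k"] ab(3) by (auto simp: positions_def)
    qed
  qed
  from induced_path_rev[OF G this] have "induced_path G (x # ?m @ [y])" by simp
  moreover have "interior (x # ?m @ [y]) = (!) p ` {a..b}"
    by (simp add: interior_def atLeastLessThanSuc_atLeastAtMost del: upt_Suc)
  moreover have "3 \<le> length (x # ?m @ [y])" using ab(1) by simp
  ultimately show ?thesis by (intro exI[of _ "x # ?m @ [y]"]) simp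
qed

lemma linked_imp_path:
  assumes G: "pair_graph G" and p: "induced_path G p" and xy: "x \<noteq> y" "x \<notin> set p" "y \<notin> set p"
    "(x, y) \<notin> parcs G" and linked: "linked (positions G p) J x y Z"
  shows "\<exists>R. induced_path G R \<and> hd R = x \<and> last R = y \<and> 3 \<le> length R \<and>
    interior R \<subseteq> set p \<and> (\<forall>z\<in>Z. \<forall>w\<in>interior R. (z, w) \<notin> parcs G)"
proof -
  obtain lo hi where "positions G p x \<inter> {lo..hi} \<noteq> {}" "positions G p y \<inter> {lo..hi} \<noteq> {}"
    and Z: "\<And>z. z \<in> Z \<Longrightarrow> positions G p z \<inter> {lo..hi} = {}"
    using linked unfolding linked_def by blast
  then obtain a0 b0 where "a0 \<in> positions G p x \<inter> {lo..hi}" "b0 \<in> positions G p y \<inter> {lo..hi}"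
    by blast
  \<comment> \<open>A pair of positions of \<open>x\<close> and \<open>y\<close> at minimum distance has no further position of either letter between.\<close>
  define Q where "Q ab \<longleftrightarrow> fst ab \<in> positions G p x \<inter> {lo..hi} \<and> snd ab \<in> positions G p y \<inter> {lo..hi}"
    for ab :: "nat \<times> nat"
  define dst where "dst ab = (fst ab - snd ab) + (snd ab - fst ab)" for ab :: "nat \<times> nat"
  have "Q (a0, b0)" using \<open>a0 \<in> _\<close> \<open>b0 \<in> _\<close> by (simp add: Q_def)
  from ex_has_least_nat[of Q, OF this, of dst] obtain ab where
    ab: "Q ab" "\<And>ab'. Q ab' \<Longrightarrow> dst ab \<le> dst ab'" by blast
  obtain a b where [simp]: "ab = (a, b)" by (cases ab)
  have a: "a \<in> positions G p x" "lo \<le> a" "a \<le> hi" and b: "b \<in> positions G p y" "lo \<le> b" "b \<le> hi"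
    using ab(1) by (auto simp: Q_def)
  have ua: "(a - b) + (b - a) \<le> (k - b) + (b - k)"
    if "k \<in> positions G p x" "lo \<le> k" "k \<le> hi" for k
    using ab(2)[of "(k, b)"] that b by (simp add: Q_def dst_def)
  have ub: "(a - b) + (b - a) \<le> (a - k) + (k - a)"
    if "k \<in> positions G p y" "lo \<le> k" "k \<le> hi" for k
    using ab(2)[of "(a, k)"] that a by (simp add: Q_def dst_def)
  have len: "a < length p" "b < length p" using a b by (auto simp: positions_def)
  have final: ?thesis if R: "induced_path G R" "hd R = x" "last R = y" "3 \<le> length R"
    "interior R = (!) p ` {min a b..max a b}" for R
  proof (intro exI[of _ R] conjI ballI)
    show "interior R \<subseteq> set p" using R(5) len by auto
    fix z w assume "z \<in> Z" "w \<in> interior R"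
    then obtain k where "k \<in> {min a b..max a b}" "w = p ! k" using R(5) by auto
    then have "k \<in> {lo..hi}" "k < length p" using a b len by auto
    then show "(z, w) \<notin> parcs G"
      using Z[OF \<open>z \<in> Z\<close>] \<open>w = p ! k\<close> by (auto simp: positions_def)
  qed (use R in auto)
  show ?thesis
  proof (cases "a \<le> b")
    case True
    have "\<exists>R. induced_path G R \<and> hd R = x \<and> last R = y \<and> 3 \<le> length R \<and> interior R = (!) p ` {a..b}"
    proof (rule linked_imp_path_aux[OF G p xy True a(1) b(1)])
      show "k = a" if "k \<in> {a..b}" "k \<in> positions G p x" for k using ua[of k] that True a b by auto
      show "k = b" if "k \<in> {a..b}" "k \<in> positions G p y" for k using ub[of k] that True a b by auto
    qed
    then show ?thesis using final True by (auto simp: min_def max_def)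
  next
    case False
    then have le: "b \<le> a" by simp
    have "\<exists>R. induced_path G R \<and> hd R = y \<and> last R = x \<and> 3 \<le> length R \<and> interior R = (!) p ` {b..a}"
    proof (rule linked_imp_path_aux[OF G p _ _ _ _ le b(1) a(1)])
      show "k = a" if "k \<in> {b..a}" "k \<in> positions G p x" for k using ua[of k] that le a b by auto
      show "k = b" if "k \<in> {b..a}" "k \<in> positions G p y" for k using ub[of k] that le a b by auto
    qed (use xy pair_graph_sym[OF G] in auto)
    then obtain R where R: "induced_path G R" "hd R = y" "last R = x" "3 \<le> length R"
      "interior R = (!) p ` {b..a}" by blast
    then show ?thesis
      using le by (intro final[of "rev R"] induced_path_rev[OF G])
        (auto simp: interior_rev hd_rev last_rev min_def max_def)
  qed
qed

text \<open>
  A walk on the natural numbers with steps of size one visits everything between its ends.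
\<close>

lemma step_path_covers:
  fixes f :: "nat \<Rightarrow> nat"
  assumes "m \<le> n" and step: "\<And>i. m \<le> i \<Longrightarrow> i < n \<Longrightarrow> f (Suc i) = Suc (f i) \<or> f i = Suc (f (Suc i))"
  shows "{min (f m) (f n)..max (f m) (f n)} \<subseteq> f ` {m..n}"
proof
  fix k assume k: "k \<in> {min (f m) (f n)..max (f m) (f n)}"
  have "\<exists>i. m \<le> i \<and> i \<le> n \<and> f i = k"
  proof (cases "f m \<le> f n")
    case True
    have "\<exists>i. m \<le> i \<and> i \<le> n \<and> int (f i) = int k"
      using True k assms(1) by (intro nat_intermed_int_val) (auto dest: step)
    then show ?thesis by simp
  next
    case False
    have "\<exists>i. m \<le> i \<and> i \<le> n \<and> - int (f i) = - int k"
      using False k assms(1) by (intro nat_intermed_int_val) (auto dest: step)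
    then show ?thesis by simp
  qed
  then show "k \<in> f ` {m..n}" by auto
qed

text \<open>
  Conversely, the interior of a route contains an interval of the path that meets the positions of
  both ends. Consecutive interior vertices of the route are adjacent, hence consecutive on the
  induced path \<open>p\<close>. The last conjunct bounds the size of the interval by the number of interior
  vertices, \<open>length R - 2\<close>.
\<close>

lemma route_interval:
  assumes G: "pair_graph G" and p: "induced_path G p" and hi: "hi < length p"
    and R: "induced_path G R" "hd R = x" "last R = y" "x \<noteq> y" "(x, y) \<notin> parcs G"
    and int: "interior R \<subseteq> (!) p ` {lo..hi}"
  shows "\<exists>a b. {a..b} \<subseteq> {lo..hi} \<and> positions G p x \<inter> {a..b} \<noteq> {} \<and>
    positions G p y \<inter> {a..b} \<noteq> {} \<and> (!) p ` {a..b} \<subseteq> set R \<and> b + 3 \<le> a + length R"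
proof -
  let ?n = "length R"
  have Ri: "R \<noteq> []" "distinct R"
    "\<And>i j. i < ?n \<Longrightarrow> j < ?n \<Longrightarrow> (R ! i, R ! j) \<in> parcs G \<longleftrightarrow> j = Suc i \<or> i = Suc j"
    using R(1) unfolding induced_path_iff[OF G] by blast+
  have pi: "\<And>i j. i < length p \<Longrightarrow> j < length p \<Longrightarrow> (p ! i, p ! j) \<in> parcs G \<longleftrightarrow> j = Suc i \<or> i = Suc j"
    using p unfolding induced_path_iff[OF G] by blast
  have x: "x = R ! 0" and y: "y = R ! (?n - 1)"
    using R(2,3) Ri(1) by (simp_all add: hd_conv_nth last_conv_nth)
  have n3: "3 \<le> ?n"
  proof (rule ccontr)
    assume "\<not> 3 \<le> ?n"
    moreover have "0 < ?n" using Ri(1) by simp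
    ultimately have "?n = 1 \<or> ?n = 2" by linarith
    moreover have "(R ! 0, R ! 1) \<in> parcs G" if "?n = 2" using Ri(3)[of 0 1] that by force
    ultimately show False using x y R(4,5) by auto
  qed
  have "\<forall>i\<in>{1..?n - 2}. \<exists>k\<in>{lo..hi}. R ! i = p ! k"
  proof
    fix i assume i: "i \<in> {1..?n - 2}"
    then have i': "i - 1 < length (butlast (tl R))" "i - 1 < length (tl R)" "Suc (i - 1) = i"
      using n3 by auto
    have "butlast (tl R) ! (i - 1) = tl R ! (i - 1)" by (rule nth_butlast[OF i'(1)])
    also have "\<dots> = R ! i" using nth_tl[OF i'(2)] i'(3) by simp
    finally have "R ! i \<in> interior R" unfolding interior_def using nth_mem[OF i'(1)] by simp
    then show "\<exists>k\<in>{lo..hi}. R ! i = p ! k" using int by auto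
  qed
  then obtain f where f: "\<And>i. i \<in> {1..?n - 2} \<Longrightarrow> f i \<in> {lo..hi} \<and> R ! i = p ! f i" by metis
  have step: "f (Suc i) = Suc (f i) \<or> f i = Suc (f (Suc i))" if "1 \<le> i" "i < ?n - 2" for i
  proof -
    have fi: "R ! i = p ! f i" "f i < length p" using f[of i] that hi by auto
    have fs: "R ! Suc i = p ! f (Suc i)" "f (Suc i) < length p" using f[of "Suc i"] that hi by auto
    have "(R ! i, R ! Suc i) \<in> parcs G" using Ri(3)[of i "Suc i"] that by simp
    then show ?thesis using pi[OF fi(2) fs(2)] fi(1) fs(1) by simp
  qed
  define a where "a = min (f 1) (f (?n - 2))"
  define b where "b = max (f 1) (f (?n - 2))"
  have cover: "{a..b} \<subseteq> f ` {1..?n - 2}"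
    unfolding a_def b_def using n3 step by (intro step_path_covers) auto
  show ?thesis
  proof (rule exI[of _ a], rule exI[of _ b], intro conjI)
    show "{a..b} \<subseteq> {lo..hi}" using cover f by blast
    have ends: "1 \<in> {1..?n - 2}" "?n - 2 \<in> {1..?n - 2}" using n3 by auto
    have "(R ! 0, R ! 1) \<in> parcs G" using Ri(1,3) n3 by simp
    then have "f 1 \<in> positions G p x" using f[OF ends(1)] hi x by (auto simp: positions_def)
    moreover have "f 1 \<in> {a..b}" by (simp add: a_def b_def)
    ultimately show "positions G p x \<inter> {a..b} \<noteq> {}" by blast
    have "?n - 1 = Suc (?n - 2)" "?n - 1 < ?n" "?n - 2 < ?n" using n3 by linarith+
    then have "(R ! (?n - 1), R ! (?n - 2)) \<in> parcs G" using Ri(3) by blast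
    then have "f (?n - 2) \<in> positions G p y"
      using f[OF ends(2)] hi y by (auto simp: positions_def)
    moreover have "f (?n - 2) \<in> {a..b}" by (simp add: a_def b_def)
    ultimately show "positions G p y \<inter> {a..b} \<noteq> {}" by blast
    show "(!) p ` {a..b} \<subseteq> set R"
    proof
      fix w assume "w \<in> (!) p ` {a..b}"
      then obtain i where i: "i \<in> {1..?n - 2}" "w = p ! f i" using cover by blast
      then have "w = R ! i" "i < ?n" using f[OF i(1)] n3 by auto
      then show "w \<in> set R" by simp
    qed
    have "card {a..b} \<le> card (f ` {1..?n - 2})" using cover by (intro card_mono) auto
    also have "\<dots> \<le> card {1..?n - 2}" by (rule card_image_le) simp
    finally show "b + 3 \<le> a + ?n" using n3 by simp
  qed
qed

lemma constellationD:
  assumes "constellation G S"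
  shows "pair_graph G" "S \<subseteq> pverts G" "\<And>x y. x \<in> S \<Longrightarrow> y \<in> S \<Longrightarrow> (x, y) \<notin> parcs G"
    "\<And>L. L \<in> comps G S \<Longrightarrow> \<exists>p. induced_path G p \<and> set p = L"
    "\<And>L x. L \<in> comps G S \<Longrightarrow> x \<in> S \<Longrightarrow> \<exists>y\<in>L. (x, y) \<in> parcs G"
  using assms unfolding constellation_def by blast+

section \<open>Complete bipartite induced subgraphs\<close>

lemma complete_bipartite_induced:
  assumes const: "constellation G S" and X: "X \<subseteq> S" "card X = r"
    and C: "C \<subseteq> comps G S" "card C = r"
    and common: "\<And>L. L \<in> C \<Longrightarrow> \<exists>v\<in>L. \<forall>x\<in>X. (x, v) \<in> parcs G"
  shows "\<exists>H. induced_subgraph (with_proj H) (with_proj G) \<and>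
    complete_bipartite_digraph r r (with_proj H)"
proof -
  note G = constellationD(1)[OF const]
  obtain v where v: "\<And>L. L \<in> C \<Longrightarrow> v L \<in> L" "\<And>L x. L \<in> C \<Longrightarrow> x \<in> X \<Longrightarrow> (x, v L) \<in> parcs G"
    using common by metis
  have vW: "v L \<in> pverts G - S" if "L \<in> C" for L
    using comps_subset[of L G S] C(1) v(1) that by blast
  have inj: "inj_on v C"
    by (rule inj_onI) (metis C(1) comps_eq subsetD v(1))
  have XG: "X \<subseteq> pverts G" using X(1) constellationD(2)[OF const] by blast
  let ?H = "induce G (X \<union> v ` C)"
  have sub: "X \<union> v ` C \<subseteq> pverts G" using XG vW by blast
  have fin: "finite (pverts G)" 
    using G by (simp add: pair_graph_def pair_digraph_def pair_fin_digraph_def pair_fin_digraph_axioms_def)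
  have "parcs ?H = X \<times> v ` C \<union> v ` C \<times> X"
  proof (intro equalityI subsetI)
    fix a assume a: "a \<in> parcs ?H"
    obtain x y where [simp]: "a = (x, y)" by (cases a)
    have xy: "(x, y) \<in> parcs G" "x \<in> X \<union> v ` C" "y \<in> X \<union> v ` C" using a by auto
    have "\<not> (x \<in> X \<and> y \<in> X)" using xy(1) X(1) constellationD(3)[OF const] by blast
    moreover have "\<not> (x \<in> v ` C \<and> y \<in> v ` C)"
    proof
      assume "x \<in> v ` C \<and> y \<in> v ` C"
      then obtain L L' where L: "L \<in> C" "L' \<in> C" "x = v L" "y = v L'" by blast
      then have "L = L'"
        using comps_no_arc[OF G, of L S L' x y] C(1) v(1) xy(1) by blast
      then show False using L xy(1) pair_graph_no_loop[OF G] by simp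
    qed
    ultimately show "a \<in> X \<times> v ` C \<union> v ` C \<times> X" using xy(2,3) by auto
  next
    fix a assume "a \<in> X \<times> v ` C \<union> v ` C \<times> X"
    then show "a \<in> parcs ?H" using v(2) pair_graph_sym[OF G] by auto
  qed
  moreover have "X \<inter> v ` C = {}" using vW X(1) by blast
  moreover have "card (v ` C) = r" using card_image[OF inj] C(2) by simp
  moreover have "finite (X \<union> v ` C)" using finite_subset[OF sub fin] .
  ultimately have "complete_bipartite_digraph r r (with_proj ?H)"
    using X(2) unfolding complete_bipartite_digraph_pair_def by auto
  then show ?thesis using induced_subgraph_induce[OF G sub] by blast
qed

section \<open>Proper subdivisions of complete graphs\<close>

text \<open>
  The path \<open>R\<close> has interior in \<open>L\<close>, and no vertex of \<open>X\<close> other than its ends has a neighbour there.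
\<close>

definition link_path ::
  "'a pair_pre_digraph \<Rightarrow> 'a set \<Rightarrow> 'a set \<Rightarrow> 'a \<Rightarrow> 'a list \<Rightarrow> 'a \<Rightarrow> bool" where
  "link_path G X L x R y \<longleftrightarrow> induced_path G R \<and> hd R = x \<and> last R = y \<and> 3 \<le> length R \<and>
     interior R \<subseteq> L \<and> (\<forall>z\<in>X - {x, y}. \<forall>w\<in>interior R. (z, w) \<notin> parcs G)"

lemma link_path_rev:
  assumes "pair_graph G" "link_path G X L x R y"
  shows "link_path G X L y (rev R) x"
  using assms induced_path_rev[OF assms(1), of R]
  by (auto simp: link_path_def interior_rev hd_rev last_rev)

text \<open>
  Distinct pairs of branch vertices are joined through distinct components, between which there are
  no edges. The bound \<open>n * n\<close> counts ordered pairs; an injection \<open>\<kappa>\<close> into the naturals selects one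
  orientation of each pair, and the path for the other orientation is the reversed list.
\<close>

lemma proper_subdivision_induced:
  assumes const: "constellation G S" and X: "X \<subseteq> S" "finite X" "card X = n"
    and C: "C \<subseteq> comps G S" "finite C" "n * n \<le> card C"
    and link: "\<And>L x y. L \<in> C \<Longrightarrow> x \<in> X \<Longrightarrow> y \<in> X \<Longrightarrow> x \<noteq> y \<Longrightarrow> \<exists>R. link_path G X L x R y"
  shows "\<exists>H. induced_subgraph (with_proj H) (with_proj G) \<and>
    (\<exists>K. complete_digraph n (with_proj K) \<and> proper_subdivision K H)"
proof -
  note G = constellationD(1)[OF const]
  have XG: "X \<subseteq> pverts G" using X(1) constellationD(2)[OF const] by blast
  obtain \<kappa> :: "'a \<Rightarrow> nat" where \<kappa>: "inj_on \<kappa> X"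
    using finite_imp_inj_to_nat_seg[OF X(2)] by blast
  have "card (X \<times> X) \<le> card C" using X(3) C(3) by (simp add: card_cartesian_product)
  then obtain c where c: "c ` (X \<times> X) \<subseteq> C" "inj_on c (X \<times> X)"
    using card_le_inj[of "X \<times> X" C] X(2) C(2) by blast
  have "\<forall>x y. \<exists>R. x \<in> X \<and> y \<in> X \<and> x \<noteq> y \<longrightarrow> link_path G X (c (x, y)) x R y"
  proof (intro allI)
    fix x y
    show "\<exists>R. x \<in> X \<and> y \<in> X \<and> x \<noteq> y \<longrightarrow> link_path G X (c (x, y)) x R y"
    proof (cases "x \<in> X \<and> y \<in> X \<and> x \<noteq> y")
      case True
      then have "c (x, y) \<in> C" using c(1) by auto
      then show ?thesis using link[of "c (x, y)" x y] True by blast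
    qed blast
  qed
  then obtain R where R: "\<And>x y. x \<in> X \<Longrightarrow> y \<in> X \<Longrightarrow> x \<noteq> y \<Longrightarrow> link_path G X (c (x, y)) x (R x y) y"
    by metis
  define P where "P = (\<lambda>(x, y). if \<kappa> x < \<kappa> y then R x y else rev (R y x))"
  define ce where "ce x y = (if \<kappa> x < \<kappa> y then c (x, y) else c (y, x))" for x y
  have \<kappa>_neq: "\<kappa> x < \<kappa> y \<or> \<kappa> y < \<kappa> x" if "x \<in> X" "y \<in> X" "x \<noteq> y" for x y
    using that \<kappa> by (meson inj_onD linorder_neqE_nat)
  have P: "link_path G X (ce x y) x (P (x, y)) y" if "x \<in> X" "y \<in> X" "x \<noteq> y" for x y
    using R[OF that] link_path_rev[OF G R[of y x]] that by (auto simp: P_def ce_def)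
  have P_rev: "P (y, x) = rev (P (x, y))" if "x \<in> X" "y \<in> X" "x \<noteq> y" for x y
    using \<kappa>_neq[OF that] by (auto simp: P_def)
  have ce: "ce x y \<in> comps G S" if "x \<in> X" "y \<in> X" for x y
    using c(1) C(1) that by (auto simp: ce_def)
  have ce_inj: "{x, y} = {u, v}"
    if "x \<in> X" "y \<in> X" "u \<in> X" "v \<in> X" "ce x y = ce u v" for x y u v
    using that inj_onD[OF c(2)] unfolding ce_def by (auto split: if_splits)
  have int_S: "w \<notin> S" "w \<in> ce x y" if "x \<in> X" "y \<in> X" "x \<noteq> y" "w \<in> interior (P (x, y))" for x y w
    using P[OF that(1-3)] that(4) comps_subset[OF ce[OF that(1,2)]] by (auto simp: link_path_def)
  have set_P: "set (P (x, y)) = {x, y} \<union> interior (P (x, y))" if "x \<in> X" "y \<in> X" "x \<noteq> y" for x y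
    using set_interior[of "P (x, y)"] P[OF that] by (auto simp: link_path_def)
  define E where "E = {(x, y). x \<in> X \<and> y \<in> X \<and> x \<noteq> y}"
  define V where "V = X \<union> (\<Union>e\<in>E. set (P e))"
  let ?K = "\<lparr>pverts = X, parcs = E\<rparr>" and ?H = "induce G V"
  have K: "complete_digraph n (with_proj ?K)"
    using X(2,3) by (auto simp: complete_digraph_pair_def E_def)
  have V: "V \<subseteq> pverts G"
    using XG P unfolding V_def E_def link_path_def induced_path_iff[OF G] by fast
  have inV: "x \<in> V" if "x \<in> X" for x using that by (simp add: V_def)
  have Parcs: "set (vwalk_arcs (P (x, y))) \<subseteq> parcs ?H" if "x \<in> X" "y \<in> X" "x \<noteq> y" for x y
  proof -
    have "set (vwalk_arcs (P (x, y))) \<subseteq> parcs G"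
      using P[OF that] induced_path_arcs_subset by (auto simp: link_path_def)
    moreover have "set (vwalk_arcs (P (x, y))) \<subseteq> set (P (x, y)) \<times> set (P (x, y))"
      by (auto simp: set_vwalk_arcs)
    moreover have "set (P (x, y)) \<subseteq> V" using that by (auto simp: V_def E_def)
    ultimately show ?thesis by auto
  qed
  have arc_in: "(u, v) \<in> (\<Union>e\<in>E. set (vwalk_arcs (P e)))"
    if "x \<in> X" "y \<in> X" "x \<noteq> y" "u \<in> set (P (x, y))" "v \<in> set (P (x, y))" "(u, v) \<in> parcs G"
    for x y u v
  proof -
    have "induced_path G (P (x, y))" using P[OF that(1-3)] by (simp add: link_path_def)
    from induced_path_arc[OF G this that(4-6)]
    have "(u, v) \<in> set (vwalk_arcs (P (x, y))) \<or> (u, v) \<in> set (vwalk_arcs (P (y, x)))"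
      using P_rev[OF that(1-3)] by simp
    moreover have "(x, y) \<in> E" "(y, x) \<in> E" using that by (auto simp: E_def)
    ultimately show ?thesis by blast
  qed
  have X_int: "(u, v) \<in> (\<Union>e\<in>E. set (vwalk_arcs (P e)))"
    if "(u, v) \<in> parcs G" "x \<in> X" "y \<in> X" "x \<noteq> y"
      "u \<in> X \<and> v \<in> interior (P (x, y)) \<or> v \<in> X \<and> u \<in> interior (P (x, y))" for u v x y
  proof -
    have "(v, u) \<in> parcs G" using that(1) pair_graph_sym[OF G] by blast
    then have "u \<in> set (P (x, y)) \<and> v \<in> set (P (x, y))"
      using that P[OF that(2-4)] set_P[OF that(2-4)] unfolding link_path_def by blast
    then show ?thesis using arc_in that by blast
  qed
  have arcs: "parcs ?H = (\<Union>e\<in>E. set (vwalk_arcs (P e)))"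
  proof (intro equalityI subsetI)
    fix a assume a: "a \<in> parcs ?H"
    obtain u v where [simp]: "a = (u, v)" by (cases a)
    have uv: "(u, v) \<in> parcs G" "u \<in> V" "v \<in> V" using a by auto
    have V_cases: "w \<in> X \<or> (\<exists>x y. x \<in> X \<and> y \<in> X \<and> x \<noteq> y \<and> w \<in> interior (P (x, y)))"
      if w: "w \<in> V" for w
    proof (cases "w \<in> X")
      case False
      then obtain e where "e \<in> E" "w \<in> set (P e)" using w unfolding V_def by blast
      then obtain x y where xy: "x \<in> X" "y \<in> X" "x \<noteq> y" "w \<in> set (P (x, y))"
        unfolding E_def by blast
      then have "w \<in> interior (P (x, y))" using set_P[OF xy(1-3)] False by auto
      then show ?thesis using xy by blast
    qed blast
    have "(u, v) \<in> (\<Union>e\<in>E. set (vwalk_arcs (P e)))"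
    proof (cases "u \<in> X")
      case uX: True
      have "v \<notin> X" using uX uv(1) X(1) constellationD(3)[OF const, of u v] by auto
      then obtain x y where "x \<in> X" "y \<in> X" "x \<noteq> y" "v \<in> interior (P (x, y))"
        using V_cases[OF uv(3)] by auto
      then show ?thesis using X_int[OF uv(1), of x y] uX by simp
    next
      case False
      then obtain x y where xy: "x \<in> X" "y \<in> X" "x \<noteq> y" "u \<in> interior (P (x, y))"
        using V_cases[OF uv(2)] by auto
      show ?thesis
      proof (cases "v \<in> X")
        case True
        then show ?thesis using X_int[OF uv(1), of x y] xy by simp
      next
        case False
        then obtain x' y' where xy': "x' \<in> X" "y' \<in> X" "x' \<noteq> y'" "v \<in> interior (P (x', y'))"
          using V_cases[OF uv(3)] by auto
        have "ce x y = ce x' y'"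
          using comps_no_arc[OF G ce[OF xy(1,2)] ce[OF xy'(1,2)] int_S(2)[OF xy] int_S(2)[OF xy'] uv(1)] .
        then have "{x, y} = {x', y'}" using ce_inj[OF xy(1,2) xy'(1,2)] by simp
        then have "P (x', y') = P (x, y) \<or> P (x', y') = rev (P (x, y))"
          using P_rev[OF xy(1-3)] by (auto simp: doubleton_eq_iff)
        then have "v \<in> interior (P (x, y))" using xy'(4) by (auto simp: interior_rev)
        then show ?thesis
          using arc_in[OF xy(1-3) _ _ uv(1)] xy(4) set_P[OF xy(1-3)] by simp
      qed
    qed
    then show "a \<in> (\<Union>e\<in>E. set (vwalk_arcs (P e)))" by simp
  qed (use Parcs in \<open>auto simp: E_def\<close>)
  have "subdivision_via ?K P ?H"
    unfolding subdivision_via_def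
  proof (intro conjI)
    show "pair_graph ?K" by (rule pair_graphI_complete[OF K])
    show "\<forall>(u, v)\<in>parcs ?K. P (u, v) \<noteq> [] \<and> hd (P (u, v)) = u \<and> last (P (u, v)) = v \<and>
        distinct (P (u, v)) \<and> P (v, u) = rev (P (u, v)) \<and> interior (P (u, v)) \<inter> pverts ?K = {}"
    proof (clarify, intro conjI)
      fix x y assume "(x, y) \<in> parcs ?K"
      then have xy: "x \<in> X" "y \<in> X" "x \<noteq> y" by (auto simp: E_def)
      show "P (x, y) \<noteq> []" "hd (P (x, y)) = x" "last (P (x, y)) = y" "distinct (P (x, y))"
        using P[OF xy] by (auto simp: link_path_def induced_path_iff[OF G])
      show "P (y, x) = rev (P (x, y))" by (rule P_rev[OF xy])
      show "interior (P (x, y)) \<inter> pverts ?K = {}" using int_S(1)[OF xy] X(1) by auto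
    qed
    show "\<forall>(u, v)\<in>parcs ?K. \<forall>(x, y)\<in>parcs ?K. {u, v} \<noteq> {x, y} \<longrightarrow>
        interior (P (u, v)) \<inter> interior (P (x, y)) = {}"
    proof (clarify, rule ccontr)
      fix u v x y assume "(u, v) \<in> parcs ?K" "(x, y) \<in> parcs ?K" and ne: "{u, v} \<noteq> {x, y}"
        and "interior (P (u, v)) \<inter> interior (P (x, y)) \<noteq> {}"
      then have uv: "u \<in> X" "v \<in> X" "u \<noteq> v" and xy: "x \<in> X" "y \<in> X" "x \<noteq> y"
        by (auto simp: E_def)
      obtain w where "w \<in> interior (P (u, v))" "w \<in> interior (P (x, y))"
        using \<open>_ \<noteq> {}\<close> by blast
      then have "ce u v = ce x y"
        using comps_eq[OF ce[OF uv(1,2)] ce[OF xy(1,2)]] int_S(2)[OF uv] int_S(2)[OF xy] by blast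
      then show False using ce_inj[OF uv(1,2) xy(1,2)] ne by blast
    qed
    show "pverts ?H = pverts ?K \<union> (\<Union>e\<in>parcs ?K. set (P e))" by (simp add: V_def)
    show "parcs ?H = (\<Union>e\<in>parcs ?K. set (vwalk_arcs (P e)))" using arcs by simp
  qed
  moreover have "\<forall>e\<in>parcs ?K. 2 \<le> vwalk_length (P e)"
    using P by (fastforce simp: E_def link_path_def)
  ultimately have "proper_subdivision ?K ?H" unfolding proper_subdivision_def by blast
  then show ?thesis using K induced_subgraph_induce[OF G V] by blast
qed

section \<open>Sub-constellations\<close>

lemma induced_path_induce:
  assumes "pair_graph G" "V \<subseteq> pverts G"
  shows "induced_path (induce G V) q \<longleftrightarrow> induced_path G q \<and> set q \<subseteq> V"
proof (cases "set q \<subseteq> V")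
  case True
  then have "q ! i \<in> V" if "i < length q" for i using that by auto
  then show ?thesis
    using True assms(2)
    unfolding induced_path_iff[OF assms(1)] induced_path_iff[OF pair_graph_induce[OF assms]]
    by auto
next
  case False
  then show ?thesis unfolding induced_path_iff[OF pair_graph_induce[OF assms]] by simp
qed

text \<open>
  From each component \<open>L\<close> in \<open>C\<close>, given by its path \<open>p L\<close>, keep the vertices with index between
  \<open>lo L\<close> and \<open>hi L\<close>; they must contain a neighbour of each vertex in \<open>T\<close>. Together with \<open>T\<close> they
  induce a constellation that sits in the given one.
\<close>

locale restricted_constellation =
  fixes G :: "'a pair_pre_digraph" and S T :: "'a set" and C :: "'a set set"
    and p :: "'a set \<Rightarrow> 'a list" and lo hi :: "'a set \<Rightarrow> nat"
  assumes const: "constellation G S" and T: "T \<subseteq> S" "T \<noteq> {}" and C: "C \<subseteq> comps G S"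
    and p: "\<And>L. L \<in> C \<Longrightarrow> induced_path G (p L)" "\<And>L. L \<in> C \<Longrightarrow> set (p L) = L"
    and hi: "\<And>L. L \<in> C \<Longrightarrow> hi L < length (p L)"
    and meet: "\<And>L x. L \<in> C \<Longrightarrow> x \<in> T \<Longrightarrow> positions G (p L) x \<inter> {lo L..hi L} \<noteq> {}"
begin

definition segment :: "'a set \<Rightarrow> 'a set" where
  "segment L = (!) (p L) ` {lo L..hi L}"

definition H :: "'a pair_pre_digraph" where
  "H = induce G (T \<union> \<Union>(segment ` C))"

lemma G: "pair_graph G"
  by (rule constellationD(1)[OF const])

lemma lo_le_hi: "L \<in> C \<Longrightarrow> lo L \<le> hi L"
  using meet T(2) by fastforce

lemma segment_subset: "L \<in> C \<Longrightarrow> segment L \<subseteq> L"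
  unfolding segment_def using hi p(2) nth_mem by fastforce

lemma segment_outside: "L \<in> C \<Longrightarrow> segment L \<subseteq> pverts G - S"
  using segment_subset comps_subset[of L G S] C by blast

lemma verts_subset: "T \<union> \<Union>(segment ` C) \<subseteq> pverts G"
  using segment_outside T(1) constellationD(2)[OF const] by blast

lemma pair_graph_H: "pair_graph H"
  unfolding H_def by (rule pair_graph_induce[OF G verts_subset])

lemma induced_H: "induced_subgraph (with_proj H) (with_proj G)"
  unfolding H_def by (rule induced_subgraph_induce[OF G verts_subset])

lemma verts_H: "pverts H - T = \<Union>(segment ` C)"
  using segment_outside T(1) unfolding H_def by auto

lemma segment_connected:
  assumes L: "L \<in> C" and "u \<in> segment L" "v \<in> segment L"
  shows "(u, v) \<in> reach H T"
proof -
  have W: "segment L \<subseteq> pverts H - T" using L unfolding verts_H by blast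
  have *: "(p L ! i, p L ! (i + k)) \<in> reach H T \<and> (p L ! (i + k), p L ! i) \<in> reach H T"
    if "lo L \<le> i" "i + k \<le> hi L" for i k
    using that(2)
  proof (induction k)
    case 0
    then have "p L ! i \<in> segment L" using that(1) unfolding segment_def by auto
    then have "p L ! i \<in> pverts H - T" using W by blast
    then show ?case unfolding reach_def by simp
  next
    case (Suc k)
    let ?x = "p L ! (i + k)" and ?y = "p L ! (i + Suc k)"
    have xy: "?x \<in> segment L" "?y \<in> segment L"
      using Suc.prems that(1) unfolding segment_def by auto
    have "i + Suc k < length (p L)" using Suc.prems hi[OF L] by simp
    then have "(?x, ?y) \<in> parcs G"
      using p(1)[OF L] unfolding induced_path_iff[OF G] by simp
    then have "(?x, ?y) \<in> parcs H" using xy L unfolding H_def by auto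
    then have "(?x, ?y) \<in> reach H T" "(?y, ?x) \<in> reach H T"
      using arc_reach[OF pair_graph_H] pair_graph_sym[OF pair_graph_H] xy W by blast+
    moreover have "(p L ! i, ?x) \<in> reach H T" "(?x, p L ! i) \<in> reach H T"
      using Suc by simp_all
    ultimately show ?case
      using reach_trans[of "p L ! i" ?x H T ?y] reach_trans[of ?y ?x H T "p L ! i"] by simp
  qed
  obtain i j where ij: "u = p L ! i" "v = p L ! j" "lo L \<le> i" "i \<le> hi L" "lo L \<le> j" "j \<le> hi L"
    using assms(2,3) unfolding segment_def by auto
  show ?thesis
  proof (cases "i \<le> j")
    case True
    then show ?thesis using *[of i "j - i"] ij by simp
  next
    case False
    then show ?thesis using *[of j "i - j"] ij by simp
  qed
qed

lemma comps_H: "comps H T = segment ` C"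
proof (rule comps_eqI)
  show "\<Union>(segment ` C) = pverts H - T" by (simp only: verts_H)
  show "Q \<noteq> {}" if "Q \<in> segment ` C" for Q
    using that lo_le_hi unfolding segment_def by fastforce
  show "(u, v) \<in> reach H T" if "Q \<in> segment ` C" "u \<in> Q" "v \<in> Q" for Q u v
    using that segment_connected by blast
  show "v \<in> Q" if Q: "Q \<in> segment ` C" "u \<in> Q" "(u, v) \<in> parcs H" "v \<notin> T" for Q u v
  proof -
    obtain L where L: "L \<in> C" "Q = segment L" using Q(1) by blast
    have uv: "(u, v) \<in> parcs G" "v \<in> T \<union> \<Union>(segment ` C)" using Q(3) by (auto simp: H_def)
    then obtain L' where L': "L' \<in> C" "v \<in> segment L'" using Q(4) by blast
    have "L = L'"
      using comps_no_arc[OF G _ _ _ _ uv(1), of L S L'] C L L' Q(2) segment_subset by blast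
    then show ?thesis using L L' by simp
  qed
qed

lemma inj_segment: "inj_on segment C"
proof (rule inj_onI)
  fix L L' assume L: "L \<in> C" "L' \<in> C" "segment L = segment L'"
  obtain u where "u \<in> segment L" using lo_le_hi[OF L(1)] unfolding segment_def by fastforce
  then show "L = L'" using comps_eq[of L G S L' u] L C segment_subset by blast
qed

lemma constellation_H: "constellation_of_size (card T) (card C) H T"
  unfolding constellation_of_size_def constellation_def
proof (intro conjI ballI)
  show "pair_graph H" by (rule pair_graph_H)
  show "T \<subseteq> pverts H" unfolding H_def by auto
  show "(x, y) \<notin> parcs H" if "x \<in> T" "y \<in> T" for x y
    using constellationD(3)[OF const, of x y] that T(1) by (auto simp: H_def)
  show "card (comps H T) = card C" unfolding comps_H using inj_segment by (rule card_image)
  fix Q assume "Q \<in> comps H T"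
  then obtain L where L: "L \<in> C" "Q = segment L" unfolding comps_H by blast
  let ?q = "map ((!) (p L)) [lo L..<Suc (hi L)]"
  have "set ?q = Q" by (simp add: L(2) segment_def atLeastLessThanSuc_atLeastAtMost del: upt_Suc)
  moreover have "induced_path G ?q"
    by (rule induced_path_slice[OF G p(1)[OF L(1)] lo_le_hi[OF L(1)] hi[OF L(1)]])
  ultimately have "induced_path H ?q \<and> set ?q = Q"
    using L unfolding H_def induced_path_induce[OF G verts_subset] by blast
  then show "\<exists>q. induced_path H q \<and> set q = Q" by blast
  fix x assume x: "x \<in> T"
  then obtain k where k: "k \<in> positions G (p L) x" "k \<in> {lo L..hi L}" using meet[OF L(1)] by blast
  then have "p L ! k \<in> Q" unfolding L(2) segment_def by blast
  moreover have "(x, p L ! k) \<in> parcs H"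
    using k x calculation L unfolding H_def positions_def by auto
  ultimately show "\<exists>y\<in>Q. (x, y) \<in> parcs H" by blast
qed (rule refl)

lemma sits_in_H: "sits_in H T G S"
  unfolding sits_in_def
proof (intro conjI ballI impI)
  show "\<exists>M\<in>comps G S. Q \<subseteq> M" if "Q \<in> comps H T" for Q
    using that segment_subset C unfolding comps_H by blast
  fix M Q Q' assume M: "M \<in> comps G S" "Q \<in> comps H T" "Q' \<in> comps H T" "Q \<subseteq> M \<and> Q' \<subseteq> M"
  have "L = M" if L: "L \<in> C" "segment L \<subseteq> M" for L
  proof -
    obtain u where "u \<in> segment L" using lo_le_hi[OF L(1)] unfolding segment_def by fastforce
    then show ?thesis using comps_eq[of L G S M u] L C M(1) segment_subset by blast
  qed
  then show "Q = Q'" using M(2-4) unfolding comps_H by blast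
qed (rule induced_H T(1))+

lemma route_interval_H:
  assumes "route H T x R y"
  obtains L a b where "L \<in> C" "{a..b} \<subseteq> {lo L..hi L}" "positions G (p L) x \<inter> {a..b} \<noteq> {}"
    "positions G (p L) y \<inter> {a..b} \<noteq> {}" "b + 3 \<le> a + length R"
    "\<And>z. z \<in> T \<Longrightarrow> \<not> has_neighbor_in H z (set R) \<Longrightarrow> positions G (p L) z \<inter> {a..b} = {}"
proof -
  have R: "induced_path H R" "hd R = x" "last R = y" "x \<in> T" "y \<in> T" "x \<noteq> y"
    and "\<exists>Q\<in>comps H T. interior R \<subseteq> Q"
    using assms unfolding route_def by blast+
  then obtain L where L: "L \<in> C" "interior R \<subseteq> segment L" unfolding comps_H by blast
  have RG: "induced_path G R" "set R \<subseteq> T \<union> \<Union>(segment ` C)"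
    using R(1) unfolding H_def induced_path_induce[OF G verts_subset] by blast+
  have "(x, y) \<notin> parcs G" using constellationD(3)[OF const] R(4,5) T(1) by blast
  from route_interval[OF G p(1)[OF L(1)] hi[OF L(1)] RG(1) R(2,3,6) this L(2)[unfolded segment_def]]
  obtain a b where ab: "{a..b} \<subseteq> {lo L..hi L}" "positions G (p L) x \<inter> {a..b} \<noteq> {}"
    "positions G (p L) y \<inter> {a..b} \<noteq> {}" "(!) (p L) ` {a..b} \<subseteq> set R" "b + 3 \<le> a + length R"
    by blast
  show ?thesis
  proof (rule that[OF L(1) ab(1-3,5)])
    fix z assume z: "z \<in> T" "\<not> has_neighbor_in H z (set R)"
    show "positions G (p L) z \<inter> {a..b} = {}"
    proof (rule ccontr)
      assume "positions G (p L) z \<inter> {a..b} \<noteq> {}"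
      then obtain k where k: "k \<in> {a..b}" "(z, p L ! k) \<in> parcs G" unfolding positions_def by blast
      then have "p L ! k \<in> set R" using ab(4) by blast
      moreover have "(z, p L ! k) \<in> parcs H" using k(2) z(1) calculation RG(2) unfolding H_def by auto
      ultimately show False using z(2) unfolding has_neighbor_in_def by blast
    qed
  qed
qed

lemma ample_H:
  assumes "\<And>L x y. L \<in> C \<Longrightarrow> x \<in> T \<Longrightarrow> y \<in> T \<Longrightarrow> x \<noteq> y \<Longrightarrow>
    \<not> close d (positions G (p L)) {lo L..hi L} x y"
  shows "ample d H T"
  unfolding ample_def
proof (intro notI, elim exE conjE)
  fix x R y assume r: "route H T x R y" "vwalk_length R \<le> d + 1"
  obtain L a b where ab: "L \<in> C" "{a..b} \<subseteq> {lo L..hi L}" "positions G (p L) x \<inter> {a..b} \<noteq> {}"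
    "positions G (p L) y \<inter> {a..b} \<noteq> {}" "b + 3 \<le> a + length R"
    by (rule route_interval_H[OF r(1)])
  have "b < a + d" using ab(5) r(2) by simp
  then have "close d (positions G (p L)) {lo L..hi L} x y" using ab unfolding close_def by blast
  then show False using assms[OF ab(1)] r(1) unfolding route_def by blast
qed

text \<open>
  Orders on \<open>T\<close> are given by injective keys.
\<close>

lemma linear_order_on_key:
  fixes \<kappa> :: "'a \<Rightarrow> nat"
  assumes "inj_on \<kappa> T"
  shows "linear_order_on T {(x, y). x \<in> T \<and> y \<in> T \<and> \<kappa> x \<le> \<kappa> y}"
  using assms
  by (auto simp: linear_order_on_def partial_order_on_def preorder_on_def refl_on_def total_on_def
      inj_on_def intro!: transI antisymI)

lemma interrupted_H:
  fixes \<kappa> :: "'a \<Rightarrow> nat"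
  assumes \<kappa>: "inj_on \<kappa> T"
    and blocked: "\<And>L x y z. L \<in> C \<Longrightarrow> x \<in> T \<Longrightarrow> y \<in> T \<Longrightarrow> z \<in> T \<Longrightarrow> \<kappa> x < \<kappa> y \<Longrightarrow> \<kappa> y < \<kappa> z \<Longrightarrow>
      \<not> linked (positions G (p L)) {lo L..hi L} x y {z}"
  shows "interrupted H T"
  unfolding interrupted_def
proof (intro exI conjI ballI impI allI)
  show "linear_order_on T {(x, y). x \<in> T \<and> y \<in> T \<and> \<kappa> x \<le> \<kappa> y}" (is "linear_order_on T ?le")
    by (rule linear_order_on_key[OF \<kappa>])
  fix x y z R assume T: "x \<in> T" "y \<in> T" "z \<in> T" and r: "route H T x R y"
    and "(x, y) \<in> ?le - Id \<and> (y, z) \<in> ?le - Id"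
  then have less: "\<kappa> x < \<kappa> y" "\<kappa> y < \<kappa> z" using inj_onD[OF \<kappa>] by fastforce+
  obtain L a b where ab: "L \<in> C" "{a..b} \<subseteq> {lo L..hi L}" "positions G (p L) x \<inter> {a..b} \<noteq> {}"
    "positions G (p L) y \<inter> {a..b} \<noteq> {}"
    "\<And>z. z \<in> T \<Longrightarrow> \<not> has_neighbor_in H z (set R) \<Longrightarrow> positions G (p L) z \<inter> {a..b} = {}"
    by (rule route_interval_H[OF r]) blast
  show "has_neighbor_in H z (set R)"
  proof (rule ccontr)
    assume "\<not> has_neighbor_in H z (set R)"
    then have "linked (positions G (p L)) {lo L..hi L} x y {z}"
      using ab T(3) by (intro linkedI[of _ _ a b]) auto
    then show False using blocked[OF ab(1) T less] by blast
  qed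
qed

lemma zigzagged_H:
  fixes \<kappa> :: "'a \<Rightarrow> nat"
  assumes \<kappa>: "inj_on \<kappa> T"
    and blocked: "\<And>L x y Z. L \<in> C \<Longrightarrow> x \<in> T \<Longrightarrow> y \<in> T \<Longrightarrow> Z \<subseteq> T \<Longrightarrow> \<kappa> x < \<kappa> y \<Longrightarrow> card Z = q \<Longrightarrow>
      (\<And>z. z \<in> Z \<Longrightarrow> \<kappa> x < \<kappa> z \<and> \<kappa> z < \<kappa> y) \<Longrightarrow>
      \<not> linked (positions G (p L)) {lo L..hi L} x y Z"
  shows "zigzagged q H T"
  unfolding zigzagged_def
proof (intro exI conjI ballI impI allI)
  show "linear_order_on T {(x, y). x \<in> T \<and> y \<in> T \<and> \<kappa> x \<le> \<kappa> y}" (is "linear_order_on T ?le")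
    by (rule linear_order_on_key[OF \<kappa>])
  fix x y R assume T: "x \<in> T" "y \<in> T" and r: "route H T x R y" and le: "(x, y) \<in> ?le - Id"
  have less: "\<kappa> u < \<kappa> v" if "(u, v) \<in> ?le - Id" for u v
    using that inj_onD[OF \<kappa>] by fastforce
  obtain L a b where ab: "L \<in> C" "{a..b} \<subseteq> {lo L..hi L}" "positions G (p L) x \<inter> {a..b} \<noteq> {}"
    "positions G (p L) y \<inter> {a..b} \<noteq> {}"
    "\<And>z. z \<in> T \<Longrightarrow> \<not> has_neighbor_in H z (set R) \<Longrightarrow> positions G (p L) z \<inter> {a..b} = {}"
    by (rule route_interval_H[OF r]) blast
  show "card {z \<in> T. (x, z) \<in> ?le - Id \<and> (z, y) \<in> ?le - Id \<and> \<not> has_neighbor_in H z (set R)} < q"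
    (is "card ?M < q")
  proof (rule ccontr)
    assume "\<not> card ?M < q"
    then have "q \<le> card ?M" by simp
    then obtain Z where Z: "Z \<subseteq> ?M" "card Z = q" by (rule obtain_subset_with_card_n)
    then have "linked (positions G (p L)) {lo L..hi L} x y Z"
      using ab by (intro linkedI[of _ _ a b]) auto
    moreover have "\<kappa> x < \<kappa> z \<and> \<kappa> z < \<kappa> y" if "z \<in> Z" for z
      using Z(1) that less by blast
    ultimately show False using blocked[OF ab(1) T _ less[OF le] Z(2)] Z(1) by blast
  qed
qed

end

section \<open>Many paths with the same outcome\<close>

lemma linked_image:
  "linked (\<lambda>i. pos (e i)) J i j Z \<longleftrightarrow> linked pos J (e i) (e j) (e ` Z)"
  by (simp add: linked_def)

lemma close_image: "close d (\<lambda>i. pos (e i)) J i j \<longleftrightarrow> close d pos J (e i) (e j)"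
  by (simp add: close_def)

lemma large_fibre:
  assumes "h \<in> A \<rightarrow> B" "finite A" "finite B" "B \<noteq> {}" "card B * M \<le> card A"
  shows "\<exists>y\<in>B. M \<le> card {x\<in>A. h x = y}"
proof -
  obtain y where y: "y \<in> B" "card A \<le> card (h -` {y} \<inter> A) * card B"
    using pigeonhole_card[OF assms(1-4)] by blast
  have fib: "h -` {y} \<inter> A = {x\<in>A. h x = y}" by auto
  have "card B * M \<le> card B * card {x\<in>A. h x = y}"
    using order_trans[OF assms(5) y(2)] unfolding fib by (simp only: mult.commute)
  then have "M \<le> card {x\<in>A. h x = y}" using assms(3,4) by (simp add: card_gt_0_iff)
  then show ?thesis using y(1) by blast
qed

lemma linked_imp_link_path:
  assumes const: "constellation G S" and L: "L \<in> comps G S" and p: "induced_path G p" "set p = L"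
    and xy: "x \<in> S" "y \<in> S" "x \<noteq> y" and linked: "linked (positions G p) J x y (X - {x, y})"
  shows "\<exists>R. link_path G X L x R y"
proof -
  have "x \<notin> set p" "y \<notin> set p" using comps_subset[OF L] p(2) xy by blast+
  from linked_imp_path[OF constellationD(1)[OF const] p(1) xy(3) this
      constellationD(3)[OF const xy(1,2)] linked]
  show ?thesis unfolding link_path_def p(2) .
qed

theorem theorem2p1:
  fixes d l l' r s s' t :: nat
  assumes "d \<ge> 1" "l \<ge> 1" "l' \<ge> 1" "r \<ge> 1" "s \<ge> 1" "s' \<ge> 1" "t \<ge> 1"
  shows "\<exists>f g :: nat. f \<ge> 1 \<and> g \<ge> 1 \<and>
    (\<forall>(G :: 'a pair_pre_digraph) S. constellation_of_size f g G S \<longrightarrow>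
       (\<exists>H :: 'a pair_pre_digraph. induced_subgraph (with_proj H) (with_proj G) \<and>
          (complete_bipartite_digraph r r (with_proj H) \<or>
           (\<exists>K :: 'a pair_pre_digraph.
              complete_digraph (2 * t + 2) (with_proj K) \<and> proper_subdivision K H)))
     \<or> (\<exists>H T. constellation_of_size s l H T \<and> ample d H T \<and> interrupted H T \<and> sits_in H T G S)
     \<or> (\<exists>H T. constellation_of_size s' l' H T \<and> ample d H T \<and> zigzagged (2 * t) H T \<and>
           sits_in H T G S))"
proof -
  let ?n = "2 * t + 2"
  obtain N where "\<forall>pos m A. finite A \<and> N \<le> card A \<and> (\<forall>x\<in>A. pos x \<inter> {0..m} \<noteq> {}) \<longrightarrow>
     (\<exists>k X. X \<subseteq> A \<and> card X = r \<and> (\<forall>x\<in>X. k \<in> pos x)) \<or>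
     (\<exists>X\<subseteq>A. card X = ?n \<and> mutually_linked pos {0..m} X) \<or>
     (\<exists>H\<subseteq>A. (\<forall>x\<in>H. \<forall>y\<in>H. x \<noteq> y \<longrightarrow> \<not> close d pos {0..m} x y) \<and>
        has_blocked_set s s' (2 * t) pos {0..m} H)"
    using single_path_outcomes[of r "2 * t" d s s'] by (rule exE)
  note N = this[rule_format]
  \<comment> \<open>\<open>M\<close> paths with the same label suffice in every case; a label is a kind of outcome together with
    the set of letters that it concerns.\<close>
  define f where "f = max N 1"
  define M where "M = r + ?n * ?n + l + l'"
  define g where "g = card ({..<5::nat} \<times> Pow {..<f}) * M"
  have labels: "finite ({..<5::nat} \<times> Pow {..<f})" "card ({..<5::nat} \<times> Pow {..<f}) > 0"
    by (simp_all add: card_cartesian_product card_Pow)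
  then have labels_ne: "{..<5::nat} \<times> Pow {..<f} \<noteq> {}" by (metis card.empty less_irrefl)
  have "f \<ge> 1" by (simp add: f_def)
  moreover have "g \<ge> 1"
    using labels(2) assms(4) by (simp add: g_def M_def Suc_le_eq)
  moreover have "(\<exists>H :: 'a pair_pre_digraph. induced_subgraph (with_proj H) (with_proj G) \<and>
          (complete_bipartite_digraph r r (with_proj H) \<or>
           (\<exists>K :: 'a pair_pre_digraph. complete_digraph ?n (with_proj K) \<and> proper_subdivision K H)))
     \<or> (\<exists>H T. constellation_of_size s l H T \<and> ample d H T \<and> interrupted H T \<and> sits_in H T G S)
     \<or> (\<exists>H T. constellation_of_size s' l' H T \<and> ample d H T \<and> zigzagged (2 * t) H T \<and>
           sits_in H T G S)"
    (is "?subgraph \<or> ?interrupted \<or> ?zigzagged")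
    if size: "constellation_of_size f g G S" for G :: "'a pair_pre_digraph" and S
  proof -
    have const: "constellation G S" and cardS: "card S = f" and cardL: "card (comps G S) = g"
      using size by (auto simp: constellation_of_size_def)
    note G = constellationD(1)[OF const]
    have finL: "finite (comps G S)" using cardL \<open>g \<ge> 1\<close> by (metis card.infinite not_one_le_zero)
    have finS: "finite S" using cardS \<open>f \<ge> 1\<close> by (metis card.infinite not_one_le_zero)
    then obtain e where e: "bij_betw e {..<f} S"
      using ex_bij_betw_nat_finite[OF finS] cardS by (auto simp: atLeast0LessThan)
    have inj_e: "inj_on e {..<f}" and eS: "\<And>i. i < f \<Longrightarrow> e i \<in> S"
      using e by (auto simp: bij_betw_def)
    define \<kappa> where "\<kappa> = inv_into {..<f} e"
    have \<kappa>: "\<kappa> (e i) = i" if "i < f" for i using inj_e that by (simp add: \<kappa>_def)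
    have "\<forall>L\<in>comps G S. \<exists>p. induced_path G p \<and> set p = L" using constellationD(4)[OF const] by blast
    then obtain p where p: "\<And>L. L \<in> comps G S \<Longrightarrow> induced_path G (p L)"
      "\<And>L. L \<in> comps G S \<Longrightarrow> set (p L) = L" by metis
    define m where "m L = length (p L) - 1" for L
    define pos where "pos L = positions G (p L)" for L
    have m_less: "m L < length (p L)" if "L \<in> comps G S" for L
      using p(1)[OF that] unfolding m_def induced_path_iff[OF G] by auto
    have meets: "pos L x \<inter> {0..m L} \<noteq> {}" if Lx: "L \<in> comps G S" "x \<in> S" for L x
    proof -
      obtain y where "y \<in> L" "(x, y) \<in> parcs G" using constellationD(5)[OF const Lx] by blast
      then obtain k where "k < length (p L)" "(x, p L ! k) \<in> parcs G"
        using p(2)[OF Lx(1)] by (metis in_set_conv_nth)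
      then have "k \<in> pos L x \<inter> {0..m L}" by (auto simp: pos_def positions_def m_def)
      then show ?thesis by blast
    qed
    define far where "far L X \<longleftrightarrow> (\<forall>i\<in>X. \<forall>j\<in>X. i \<noteq> j \<longrightarrow> \<not> close d (\<lambda>i. pos L (e i)) {0..m L} i j)"
      for L X
    define blocked where "blocked Q L X \<longleftrightarrow> far L X \<and> (\<exists>lo hi. {lo..hi} \<subseteq> {0..m L} \<and>
      (\<forall>i\<in>X. pos L (e i) \<inter> {lo..hi} \<noteq> {}) \<and> Q (\<lambda>i. pos L (e i)) {lo..hi} X)"
      for Q :: "(nat \<Rightarrow> nat set) \<Rightarrow> nat set \<Rightarrow> nat set \<Rightarrow> bool" and L X
    \<comment> \<open>The kinds are: common neighbour, mutually linked, and the three kinds of blocked sets.\<close>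
    define out where "out k L X \<longleftrightarrow>
        k = 0 \<and> card X = r \<and> (\<exists>v. \<forall>i\<in>X. v \<in> pos L (e i)) \<or>
        k = 1 \<and> card X = ?n \<and> mutually_linked (\<lambda>i. pos L (e i)) {0..m L} X \<or>
        k = 2 \<and> card X = s \<and> blocked upper_blocked L X \<or>
        k = 3 \<and> card X = s \<and> blocked lower_blocked L X \<or>
        k = 4 \<and> card X = s' \<and> blocked (between_blocked (2 * t)) L X" for k :: nat and L X
    have "\<exists>k X. k < 5 \<and> X \<subseteq> {..<f} \<and> out k L X" if L: "L \<in> comps G S" for L
    proof -
      have "finite {..<f} \<and> N \<le> card {..<f} \<and> (\<forall>i\<in>{..<f}. pos L (e i) \<inter> {0..m L} \<noteq> {})"
        using meets[OF L eS] by (simp add: f_def)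
      from N[OF this] consider
          k X where "X \<subseteq> {..<f}" "card X = r" "\<forall>i\<in>X. k \<in> pos L (e i)"
        | X where "X \<subseteq> {..<f}" "card X = ?n" "mutually_linked (\<lambda>i. pos L (e i)) {0..m L} X"
        | X where "X \<subseteq> {..<f}" "far L X"
            "has_blocked_set s s' (2 * t) (\<lambda>i. pos L (e i)) {0..m L} X"
        unfolding far_def by blast
      then show ?thesis
      proof cases
        case 1
        then show ?thesis by (intro exI[of _ "0::nat"] exI[of _ X]) (auto simp: out_def)
      next
        case 2
        then show ?thesis by (intro exI[of _ "1::nat"] exI[of _ X]) (auto simp: out_def)
      next
        case 3
        then obtain T lo hi where T: "T \<subseteq> X" "{lo..hi} \<subseteq> {0..m L}"
          "\<forall>i\<in>T. pos L (e i) \<inter> {lo..hi} \<noteq> {}"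
          and cases: "card T = s \<and> (upper_blocked (\<lambda>i. pos L (e i)) {lo..hi} T \<or>
              lower_blocked (\<lambda>i. pos L (e i)) {lo..hi} T) \<or>
            card T = s' \<and> between_blocked (2 * t) (\<lambda>i. pos L (e i)) {lo..hi} T"
          unfolding has_blocked_set_def by blast
        have "far L T" using 3(2) T(1) unfolding far_def by blast
        then have bl: "blocked Q L T" if "Q (\<lambda>i. pos L (e i)) {lo..hi} T" for Q
          unfolding blocked_def using T(2,3) that by blast
        have Tf: "T \<subseteq> {..<f}" using T(1) 3(1) by blast
        from cases consider "out 2 L T" | "out 3 L T" | "out 4 L T"
          unfolding out_def using bl[of upper_blocked] bl[of lower_blocked]
            bl[of "between_blocked (2 * t)"] by (elim disjE conjE) simp_all
        then show ?thesis
        proof cases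
          case 1 with Tf show ?thesis by (intro exI[of _ "2::nat"] exI[of _ T]) simp
        next
          case 2 with Tf show ?thesis by (intro exI[of _ "3::nat"] exI[of _ T]) simp
        next
          case 3 with Tf show ?thesis by (intro exI[of _ "4::nat"] exI[of _ T]) simp
        qed
      qed
    qed
    then obtain tag set_of where out: "\<And>L. L \<in> comps G S \<Longrightarrow> tag L < 5"
      "\<And>L. L \<in> comps G S \<Longrightarrow> set_of L \<subseteq> {..<f}" "\<And>L. L \<in> comps G S \<Longrightarrow> out (tag L) L (set_of L)"
      by metis
    let ?label = "\<lambda>L. (tag L, set_of L)"
    have label: "?label \<in> comps G S \<rightarrow> {..<5} \<times> Pow {..<f}" using out(1,2) by auto
    have "card ({..<5::nat} \<times> Pow {..<f}) * M \<le> card (comps G S)"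
      unfolding cardL g_def ..
    from large_fibre[OF label finL labels(1) labels_ne this]
    obtain y where y: "y \<in> {..<5::nat} \<times> Pow {..<f}" "M \<le> card {L\<in>comps G S. ?label L = y}"
      by blast
    obtain k X where kX: "y = (k, X)" by (cases y)
    have X: "X \<subseteq> {..<f}" using y(1) kX by auto
    have fibre: "\<exists>C\<subseteq>comps G S. finite C \<and> card C = c \<and> (\<forall>L\<in>C. out k L X)" if c: "c \<le> M" for c
    proof -
      obtain C where C: "C \<subseteq> {L\<in>comps G S. ?label L = y}" "card C = c" "finite C"
        using obtain_subset_with_card_n[OF order_trans[OF c y(2)]] by metis
      have "out k L X" if "L \<in> C" for L using out(3)[of L] C(1) that kX by auto
      moreover have "C \<subseteq> comps G S" using C(1) by auto
      ultimately show ?thesis using C(2,3) by blast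
    qed
    have eX: "e ` X \<subseteq> S" using eS X by auto
    have inj_X: "inj_on e X" by (rule inj_on_subset[OF inj_e X])
    have card_eX: "card (e ` X) = card X" by (rule card_image[OF inj_X])
    have finX: "finite X" using finite_subset[OF X] by simp
    \<comment> \<open>The subpaths on which \<open>X\<close> is blocked, chosen for all paths in \<open>C\<close>, form a sub-constellation; that
      the letters are pairwise far apart is inherited by subpaths.\<close>
    have restrict: "\<exists>lo hi. restricted_constellation G S (e ` X) C p lo hi \<and>
        (\<forall>L\<in>C. \<forall>x\<in>e ` X. \<forall>y\<in>e ` X. x \<noteq> y \<longrightarrow>
           \<not> close d (positions G (p L)) {lo L..hi L} x y) \<and>
        (\<forall>L\<in>C. Q (\<lambda>i. positions G (p L) (e i)) {lo L..hi L} X)"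
      if C: "C \<subseteq> comps G S" and bl: "\<forall>L\<in>C. blocked Q L X" and "card X \<ge> 1" for C Q
    proof -
      have Xne: "X \<noteq> {}" using that(3) by auto
      have "\<forall>L\<in>C. \<exists>lo hi. {lo..hi} \<subseteq> {0..m L} \<and> (\<forall>i\<in>X. pos L (e i) \<inter> {lo..hi} \<noteq> {}) \<and>
          Q (\<lambda>i. pos L (e i)) {lo..hi} X"
        using bl unfolding blocked_def by blast
      then obtain lo hi where lohi: "\<And>L. L \<in> C \<Longrightarrow> {lo L..hi L} \<subseteq> {0..m L}"
        "\<And>L i. L \<in> C \<Longrightarrow> i \<in> X \<Longrightarrow> pos L (e i) \<inter> {lo L..hi L} \<noteq> {}"
        "\<And>L. L \<in> C \<Longrightarrow> Q (\<lambda>i. pos L (e i)) {lo L..hi L} X"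
        by metis
      have "restricted_constellation G S (e ` X) C p lo hi"
      proof
        fix L assume L: "L \<in> C"
        then have L': "L \<in> comps G S" using C by blast
        show "induced_path G (p L)" "set (p L) = L" by (rule p[OF L'])+
        obtain i where "i \<in> X" using Xne by blast
        then have "lo L \<le> hi L" using lohi(2)[OF L, of i] by auto
        then show "hi L < length (p L)" using lohi(1)[OF L] m_less[OF L'] by auto
        fix x assume "x \<in> e ` X"
        then show "positions G (p L) x \<inter> {lo L..hi L} \<noteq> {}" using lohi(2)[OF L] unfolding pos_def by blast
      qed (use const eX Xne C in auto)
      moreover have "\<not> close d (positions G (p L)) {lo L..hi L} x y"
        if L: "L \<in> C" and xy: "x \<in> e ` X" "y \<in> e ` X" "x \<noteq> y" for L x y
      proof
        obtain i j where ij: "i \<in> X" "x = e i" "j \<in> X" "y = e j" using xy by blast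
        assume "close d (positions G (p L)) {lo L..hi L} x y"
        then have "close d (positions G (p L)) {0..m L} (e i) (e j)"
          unfolding ij close_def using lohi(1)[OF L] by (meson subset_trans)
        then have "close d (\<lambda>i. pos L (e i)) {0..m L} i j" unfolding close_image pos_def .
        moreover have "far L X" using bspec[OF bl L] by (simp add: blocked_def)
        moreover have "i \<noteq> j" using xy(3) unfolding ij by auto
        ultimately show False using ij(1,3) unfolding far_def by simp
      qed
      moreover have "Q (\<lambda>i. positions G (p L) (e i)) {lo L..hi L} X" if "L \<in> C" for L
        using lohi(3)[OF that] unfolding pos_def .
      ultimately show ?thesis by (rule_tac exI[of _ lo], rule_tac exI[of _ hi]) simp
    qed
    have \<kappa>X: "\<kappa> (e i) = i" if "i \<in> X" for i using \<kappa> that X by blast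
    have inj_\<kappa>: "inj_on \<kappa> (e ` X)" by (rule inj_onI) (auto simp: \<kappa>X)
    obtain L0 where "L0 \<in> comps G S" "out k L0 X"
      using fibre[of 1] assms(4) by (auto simp: M_def card_1_singleton_iff)
    then consider (bipartite) "k = 0" "card X = r" | (complete) "k = 1" "card X = ?n"
      | (upper) "k = 2" "card X = s" | (lower) "k = 3" "card X = s" | (between) "k = 4" "card X = s'"
      unfolding out_def by blast
    then show ?thesis
    proof cases
      case bipartite
      obtain C where C: "C \<subseteq> comps G S" "card C = r" "\<And>L. L \<in> C \<Longrightarrow> out k L X"
        using fibre[of r] by (auto simp: M_def)
      have "\<exists>v\<in>L. \<forall>x\<in>e ` X. (x, v) \<in> parcs G" if L: "L \<in> C" for L
      proof -
        obtain v where v: "\<forall>i\<in>X. v \<in> pos L (e i)" using C(3)[OF L] bipartite(1) by (auto simp: out_def)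
        have "X \<noteq> {}" using bipartite(2) assms(4) by auto
        then have "v < length (p L)" using v by (auto simp: pos_def positions_def)
        then have "p L ! v \<in> L" using p(2)[of L] C(1) L nth_mem by blast
        then show ?thesis using v by (auto simp: pos_def positions_def)
      qed
      then show ?thesis
        using complete_bipartite_induced[OF const eX _ C(1,2)] card_eX bipartite(2) by auto
    next
      case complete
      obtain C where C: "C \<subseteq> comps G S" "finite C" "card C = ?n * ?n" "\<And>L. L \<in> C \<Longrightarrow> out k L X"
        using fibre[of "?n * ?n"] by (auto simp: M_def)
      have "\<exists>R. link_path G (e ` X) L x R y"
        if L: "L \<in> C" and xy: "x \<in> e ` X" "y \<in> e ` X" "x \<noteq> y" for L x y
      proof -
        obtain i j where ij: "i \<in> X" "x = e i" "j \<in> X" "y = e j" using xy by blast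
        have "mutually_linked (\<lambda>i. pos L (e i)) {0..m L} X"
          using C(4)[OF L] complete(1) by (simp add: out_def)
        moreover have "i \<noteq> j" using xy(3) unfolding ij by auto
        ultimately have "linked (\<lambda>i. pos L (e i)) {0..m L} i j (X - {i, j})"
          using ij(1,3) unfolding mutually_linked_def by simp
        then have "linked (positions G (p L)) {0..m L} x y (e ` (X - {i, j}))"
          unfolding linked_image ij pos_def .
        moreover have "e ` (X - {i, j}) = e ` X - {x, y}"
          using inj_on_image_set_diff[OF inj_X, of X "{i, j}"] ij by auto
        ultimately have link: "linked (positions G (p L)) {0..m L} x y (e ` X - {x, y})" by simp
        have L': "L \<in> comps G S" using C(1) L by blast
        have "x \<in> S" "y \<in> S" using xy eX by auto
        then show ?thesis
          using linked_imp_link_path[OF const L' p(1)[OF L'] p(2)[OF L'] _ _ xy(3) link] by blast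
      qed
      then have "\<exists>H. induced_subgraph (with_proj H) (with_proj G) \<and>
          (\<exists>K. complete_digraph ?n (with_proj K) \<and> proper_subdivision K H)"
        using C(3) card_eX complete(2) finX
        by (intro proper_subdivision_induced[OF const eX _ _ C(1,2)]) simp_all
      then have ?subgraph by blast
      then show ?thesis ..
    next
      case upper
      obtain C where C: "C \<subseteq> comps G S" "card C = l" "\<forall>L\<in>C. blocked upper_blocked L X"
        using fibre[of l] upper(1) by (auto simp: M_def out_def)
      have ne: "card X \<ge> 1" using upper(2) assms(5) by simp
      from restrict[OF C(1,3) ne]
      obtain lo hi where R: "restricted_constellation G S (e ` X) C p lo hi"
        and far: "\<forall>L\<in>C. \<forall>x\<in>e ` X. \<forall>y\<in>e ` X. x \<noteq> y \<longrightarrow>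
           \<not> close d (positions G (p L)) {lo L..hi L} x y"
        and bl: "\<forall>L\<in>C. upper_blocked (\<lambda>i. positions G (p L) (e i)) {lo L..hi L} X"
        by (elim exE conjE) (rule that)
      interpret R: restricted_constellation G S "e ` X" C p lo hi by (rule R)
      have "interrupted R.H (e ` X)"
      proof (rule R.interrupted_H[OF inj_\<kappa>])
        fix L x y z assume L: "L \<in> C" and xyz: "x \<in> e ` X" "y \<in> e ` X" "z \<in> e ` X"
          and less: "\<kappa> x < \<kappa> y" "\<kappa> y < \<kappa> z"
        obtain i j k where ijk: "i \<in> X" "x = e i" "j \<in> X" "y = e j" "k \<in> X" "z = e k"
          using xyz by blast
        then have "i < j" "j < k" using less \<kappa>X by auto
        then have "\<not> linked (\<lambda>i. positions G (p L) (e i)) {lo L..hi L} i j {k}"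
          using bspec[OF bl L] ijk(1,3,5) unfolding upper_blocked_def by blast
        then show "\<not> linked (positions G (p L)) {lo L..hi L} x y {z}"
          unfolding linked_image ijk by simp
      qed
      moreover have "constellation_of_size s l R.H (e ` X)"
        using R.constellation_H card_eX upper(2) C(2) by simp
      ultimately have ?interrupted using R.ample_H[of d] far R.sits_in_H by blast
      then show ?thesis by blast
    next
      case lower
      obtain C where C: "C \<subseteq> comps G S" "card C = l" "\<forall>L\<in>C. blocked lower_blocked L X"
        using fibre[of l] lower(1) by (auto simp: M_def out_def)
      have ne: "card X \<ge> 1" using lower(2) assms(5) by simp
      from restrict[OF C(1,3) ne]
      obtain lo hi where R: "restricted_constellation G S (e ` X) C p lo hi"
        and far: "\<forall>L\<in>C. \<forall>x\<in>e ` X. \<forall>y\<in>e ` X. x \<noteq> y \<longrightarrow>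
           \<not> close d (positions G (p L)) {lo L..hi L} x y"
        and bl: "\<forall>L\<in>C. lower_blocked (\<lambda>i. positions G (p L) (e i)) {lo L..hi L} X"
        by (elim exE conjE) (rule that)
      interpret R: restricted_constellation G S "e ` X" C p lo hi by (rule R)
      have \<kappa>_less: "\<kappa> x < f" if "x \<in> e ` X" for x using that \<kappa>X X by auto
      \<comment> \<open>The reversed order, as a key with values in the naturals.\<close>
      have inj_rev: "inj_on (\<lambda>x. f - \<kappa> x) (e ` X)"
      proof (rule inj_onI)
        fix x y assume xy: "x \<in> e ` X" "y \<in> e ` X" "f - \<kappa> x = f - \<kappa> y"
        then have "\<kappa> x = \<kappa> y" using \<kappa>_less[OF xy(1)] \<kappa>_less[OF xy(2)] by linarith
        then show "x = y" using inj_onD[OF inj_\<kappa>] xy by blast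
      qed
      have "interrupted R.H (e ` X)"
      proof (rule R.interrupted_H[OF inj_rev])
        fix L x y z assume L: "L \<in> C" and xyz: "x \<in> e ` X" "y \<in> e ` X" "z \<in> e ` X"
          and less: "f - \<kappa> x < f - \<kappa> y" "f - \<kappa> y < f - \<kappa> z"
        obtain i j k where ijk: "i \<in> X" "x = e i" "j \<in> X" "y = e j" "k \<in> X" "z = e k"
          using xyz by blast
        have "k < j" "j < i" using less unfolding ijk \<kappa>X[OF ijk(1)] \<kappa>X[OF ijk(3)] \<kappa>X[OF ijk(5)]
          by linarith+
        then have "\<not> linked (\<lambda>i. positions G (p L) (e i)) {lo L..hi L} j i {k}"
          using bspec[OF bl L] ijk(1,3,5) unfolding lower_blocked_def by blast
        then show "\<not> linked (positions G (p L)) {lo L..hi L} x y {z}"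
          unfolding linked_image ijk linked_commute[of _ _ "e i"] by simp
      qed
      moreover have "constellation_of_size s l R.H (e ` X)"
        using R.constellation_H card_eX lower(2) C(2) by simp
      ultimately have ?interrupted using R.ample_H[of d] far R.sits_in_H by blast
      then show ?thesis by blast
    next
      case between
      obtain C where C: "C \<subseteq> comps G S" "card C = l'"
        "\<forall>L\<in>C. blocked (between_blocked (2 * t)) L X"
        using fibre[of l'] between(1) by (auto simp: M_def out_def)
      have ne: "card X \<ge> 1" using between(2) assms(6) by simp
      from restrict[OF C(1,3) ne]
      obtain lo hi where R: "restricted_constellation G S (e ` X) C p lo hi"
        and far: "\<forall>L\<in>C. \<forall>x\<in>e ` X. \<forall>y\<in>e ` X. x \<noteq> y \<longrightarrow>
           \<not> close d (positions G (p L)) {lo L..hi L} x y"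
        and bl: "\<forall>L\<in>C. between_blocked (2 * t) (\<lambda>i. positions G (p L) (e i)) {lo L..hi L} X"
        by (elim exE conjE) (rule that)
      interpret R: restricted_constellation G S "e ` X" C p lo hi by (rule R)
      have "zigzagged (2 * t) R.H (e ` X)"
      proof (rule R.zigzagged_H[OF inj_\<kappa>])
        fix L x y Z assume L: "L \<in> C" and xy: "x \<in> e ` X" "y \<in> e ` X" and Z: "Z \<subseteq> e ` X" "card Z = 2 * t"
          and less: "\<kappa> x < \<kappa> y" "\<And>z. z \<in> Z \<Longrightarrow> \<kappa> x < \<kappa> z \<and> \<kappa> z < \<kappa> y"
        obtain i j where ij: "i \<in> X" "x = e i" "j \<in> X" "y = e j" using xy by blast
        obtain Y where Y: "Y \<subseteq> X" "Z = e ` Y" using Z(1) by (rule subset_imageE)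
        have cY: "card Y = 2 * t" using Z(2) card_image[OF inj_on_subset[OF inj_X Y(1)]] Y(2) by simp
        have ijl: "i < j" using less(1) unfolding ij \<kappa>X[OF ij(1)] \<kappa>X[OF ij(3)] .
        have kl: "i < k \<and> k < j" if "k \<in> Y" for k
        proof -
          have "k \<in> X" "e k \<in> Z" using that Y by auto
          then show ?thesis
            using less(2)[of "e k"] unfolding ij \<kappa>X[OF ij(1)] \<kappa>X[OF ij(3)] by (simp add: \<kappa>X)
        qed
        have "\<not> linked (\<lambda>i. positions G (p L) (e i)) {lo L..hi L} i j Y"
          using bspec[OF bl L] ij(1,3) Y(1) ijl cY kl unfolding between_blocked_def by blast
        then show "\<not> linked (positions G (p L)) {lo L..hi L} x y Z"
          unfolding linked_image ij Y(2) .
      qed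
      moreover have "constellation_of_size s' l' R.H (e ` X)"
        using R.constellation_H card_eX between(2) C(2) by simp
      ultimately have ?zigzagged using R.ample_H[of d] far R.sits_in_H by blast
      then show ?thesis by blast
    qed
  qed
  ultimately show ?thesis by blast
qed

end
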